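(* Let $T$ be a countable tree with all vertex degrees $\ge3$, $P$ a stochastic nearest-neighbour transition matrix on $T$ invariant under a group $\Gamma\le\mathrm{Aut}(T)$ acting transitively on vertices, with orbit data $I,p_j,-j,d_j$ as below, and assume $\sum_{j\in I}d_jp_{-j}<\infty$. Let $\kappa=\max\{2\sqrt{p_jp_{-j}}:j\in I\}$, $\mathcal U=\{\lambda\in\mathbb C:|\lambda|>\rho\}\setminus\{\pm it:\rho<t\le\kappa\}$ and $\mathcal W=\mathbb C\setminus\{\pm it:t\ge1/\kappa\}$. Define $$\Phi(t)=1+\sum_{j\in I}\frac{d_j}{2}\Bigl(\sqrt{1+4p_jp_{-j}t^2}-1\Bigr).$$ Then $\Phi$ is analytic on $\mathcal W$, and for all $\lambda\in\mathcal U$, $\lambda\,G(\lambda)=\Phi(G(\lambda))$. Furthermore $\rho=\min\{\Phi(t)/t:t>0\}=\Phi(\theta)/\theta$, where $\theta$ is the unique positive real solution of $\Phi'(t)=\Phi(t)/t$.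
   Context: Nearest-neighbour stochastic: $p(x,y)>0$ iff $x\sim y$, rows sum to $1$; invariance: $p(\gamma x,\gamma y)=p(x,y)$. $I$ is the set of $\Gamma$-orbits on oriented edges; for $j\in I$ the orbit of $(x,y)$: $p_j=p(x,y)$, $-j$ the orbit of $(y,x)$, $d_j$ the number of neighbours $y$ of a fixed vertex $x$ with $(x,y)\in j$. With root $o$ and $\mathsf m(x)=\prod_{i=1}^k p(x_{i-1},x_i)/p(x_i,x_{i-1})$ along $\pi(o,x)=[x_0,\dots,x_k]$, $P$ is self-adjoint on $\ell^2(T,\mathsf m)$; $\rho$ is its spectral radius, $\rho=\limsup_n p^{(n)}(x,y)^{1/n}$. $G(\lambda)=((\lambda I-P)^{-1}\mathbf 1_x)(x)$ (independent of $x$) for $\lambda$ in the resolvent set. Square roots use the principal branch on $\mathbb C\setminus(-\infty,0]$. *)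

theory Defs
  imports "HOL-Analysis.Analysis"
begin

definition is_cycle :: "('v \<Rightarrow> 'v \<Rightarrow> bool) \<Rightarrow> 'v list \<Rightarrow> bool" where
  "is_cycle adj cs \<longleftrightarrow> length cs \<ge> 3 \<and> distinct cs \<and>
     (\<forall>i. Suc i < length cs \<longrightarrow> adj (cs ! i) (cs ! Suc i)) \<and> adj (last cs) (hd cs)"

definition is_tree :: "('v \<Rightarrow> 'v \<Rightarrow> bool) \<Rightarrow> bool" where
  "is_tree adj \<longleftrightarrow> (\<forall>x y. adj x y \<longrightarrow> adj y x) \<and> (\<forall>x. \<not> adj x x) \<and>
     (\<forall>x y. adj\<^sup>*\<^sup>* x y) \<and> (\<nexists>cs. is_cycle adj cs)"

definition nbrs :: "('v \<Rightarrow> 'v \<Rightarrow> bool) \<Rightarrow> 'v \<Rightarrow> 'v set" where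
  "nbrs adj x = {y. adj x y}"

definition min_degree3 :: "('v \<Rightarrow> 'v \<Rightarrow> bool) \<Rightarrow> bool" where
  "min_degree3 adj \<longleftrightarrow> (\<forall>x. infinite (nbrs adj x) \<or> card (nbrs adj x) \<ge> 3)"

definition is_aut :: "('v \<Rightarrow> 'v \<Rightarrow> bool) \<Rightarrow> ('v \<Rightarrow> 'v) \<Rightarrow> bool" where
  "is_aut adj g \<longleftrightarrow> bij g \<and> (\<forall>x y. adj (g x) (g y) \<longleftrightarrow> adj x y)"

definition aut_subgroup :: "('v \<Rightarrow> 'v \<Rightarrow> bool) \<Rightarrow> ('v \<Rightarrow> 'v) set \<Rightarrow> bool" where
  "aut_subgroup adj \<Gamma> \<longleftrightarrow> (\<forall>g\<in>\<Gamma>. is_aut adj g) \<and> id \<in> \<Gamma> \<and>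
     (\<forall>g\<in>\<Gamma>. \<forall>h\<in>\<Gamma>. g \<circ> h \<in> \<Gamma>) \<and> (\<forall>g\<in>\<Gamma>. inv g \<in> \<Gamma>)"

definition vertex_transitive :: "('v \<Rightarrow> 'v) set \<Rightarrow> bool" where
  "vertex_transitive \<Gamma> \<longleftrightarrow> (\<forall>x y. \<exists>g\<in>\<Gamma>. g x = y)"

definition nn_stochastic :: "('v \<Rightarrow> 'v \<Rightarrow> bool) \<Rightarrow> ('v \<Rightarrow> 'v \<Rightarrow> real) \<Rightarrow> bool" where
  "nn_stochastic adj p \<longleftrightarrow> (\<forall>x y. p x y \<ge> 0) \<and> (\<forall>x y. p x y > 0 \<longleftrightarrow> adj x y) \<and>
     (\<forall>x. (p x has_sum 1) UNIV)"

definition invariant :: "('v \<Rightarrow> 'v) set \<Rightarrow> ('v \<Rightarrow> 'v \<Rightarrow> real) \<Rightarrow> bool" where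
  "invariant \<Gamma> p \<longleftrightarrow> (\<forall>g\<in>\<Gamma>. \<forall>x y. p (g x) (g y) = p x y)"

definition edge_orbit :: "('v \<Rightarrow> 'v) set \<Rightarrow> 'v \<Rightarrow> 'v \<Rightarrow> ('v \<times> 'v) set" where
  "edge_orbit \<Gamma> x y = {(g x, g y) | g. g \<in> \<Gamma>}"

definition edge_orbits :: "('v \<Rightarrow> 'v \<Rightarrow> bool) \<Rightarrow> ('v \<Rightarrow> 'v) set \<Rightarrow> ('v \<times> 'v) set set" where
  "edge_orbits adj \<Gamma> = {edge_orbit \<Gamma> x y | x y. adj x y}"

text \<open>\<open>p_j = p(x,y)\<close> for any \<open>(x,y) \<in> j\<close>.\<close>
definition orbit_p :: "('v \<Rightarrow> 'v \<Rightarrow> real) \<Rightarrow> ('v \<times> 'v) set \<Rightarrow> real" where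
  "orbit_p p j = (let e = (SOME e. e \<in> j) in p (fst e) (snd e))"

definition orbit_rev :: "('v \<times> 'v) set \<Rightarrow> ('v \<times> 'v) set" where
  "orbit_rev j = (\<lambda>(x, y). (y, x)) ` j"

definition orbit_d :: "'v \<Rightarrow> ('v \<times> 'v) set \<Rightarrow> nat" where
  "orbit_d r j = card {y. (r, y) \<in> j}"

fun nstep :: "('v \<Rightarrow> 'v \<Rightarrow> real) \<Rightarrow> nat \<Rightarrow> 'v \<Rightarrow> 'v \<Rightarrow> real" where
  "nstep p 0 x y = (if x = y then 1 else 0)"
| "nstep p (Suc n) x y = (\<Sum>\<^sub>\<infinity>z. p x z * nstep p n z y)"

definition spec_rad :: "('v \<Rightarrow> 'v \<Rightarrow> real) \<Rightarrow> 'v \<Rightarrow> real" where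
  "spec_rad p r = real_of_ereal (limsup (\<lambda>n. ereal (nstep p n r r powr (1 / real n))))"

text \<open>Green function \<open>G(\<lambda>) = ((\<lambda>I - P)\<^sup>-\<^sup>1 1_o)(o)\<close>, for \<open>|\<lambda>| > \<rho>\<close> given by the
  (convergent) Neumann series \<open>\<Sum>_n p^(n)(o,o) \<lambda>^{-n-1}\<close>.\<close>
definition green :: "('v \<Rightarrow> 'v \<Rightarrow> real) \<Rightarrow> 'v \<Rightarrow> complex \<Rightarrow> complex" where
  "green p r z = (\<Sum>n. complex_of_real (nstep p n r r) / z ^ Suc n)"

definition Phi :: "('v \<Rightarrow> 'v \<Rightarrow> bool) \<Rightarrow> ('v \<Rightarrow> 'v) set \<Rightarrow> ('v \<Rightarrow> 'v \<Rightarrow> real) \<Rightarrow> 'v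
                     \<Rightarrow> complex \<Rightarrow> complex" where
  "Phi adj \<Gamma> p r t = 1 + (\<Sum>\<^sub>\<infinity>j\<in>edge_orbits adj \<Gamma>.
      of_nat (orbit_d r j) / 2 *
      (csqrt (1 + 4 * of_real (orbit_p p j * orbit_p p (orbit_rev j)) * t ^ 2) - 1))"

definition kappa :: "('v \<Rightarrow> 'v \<Rightarrow> bool) \<Rightarrow> ('v \<Rightarrow> 'v) set \<Rightarrow> ('v \<Rightarrow> 'v \<Rightarrow> real) \<Rightarrow> real" where
  "kappa adj \<Gamma> p = Sup ((\<lambda>j. 2 * sqrt (orbit_p p j * orbit_p p (orbit_rev j))) ` edge_orbits adj \<Gamma>)"

definition U_set :: "real \<Rightarrow> real \<Rightarrow> complex set" where
  "U_set \<rho> \<kappa> = {z. cmod z > \<rho>} - {\<i> * of_real t | t. \<rho> < t \<and> t \<le> \<kappa>}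
                                 - {- \<i> * of_real t | t. \<rho> < t \<and> t \<le> \<kappa>}"

definition W_set :: "real \<Rightarrow> complex set" where
  "W_set \<kappa> = UNIV - {\<i> * of_real t | t. t \<ge> 1 / \<kappa>} - {- \<i> * of_real t | t. t \<ge> 1 / \<kappa>}"

end

theory Submission
  imports Defs "HOL-Complex_Analysis.Complex_Analysis" "HOL-Library.Transitive_Closure_Table"
begin

text \<open>
  Fix \<open>t > 0\<close>. Multiplying suitable weights along geodesics to the root \<open>r\<close> gives a positive
  function \<open>g\<close> with \<open>g r = 1\<close> and \<open>P g = (\<Phi>(t) / t) g - 1\<^sub>r / t\<close>. Since \<open>g\<close> is superharmonic for
  \<open>\<Phi>(t) / t\<close>, this bounds \<open>\<rho> \<le> \<Phi>(t) / t\<close>. For \<open>t < 1\<close> the function \<open>g\<close> is bounded, so \<open>t g\<close> is the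
  resolvent and \<open>G(\<Phi>(t) / t) = t\<close>: the functional equation holds on a real interval.
  It extends to \<open>{Re z > 0, |z| > \<rho>}\<close> by the identity theorem as soon as \<open>G\<close> avoids the branch cuts
  of \<open>\<Phi>\<close> there. Reversibility makes the return probabilities a positive definite moment sequence,
  and because the walk is bipartite this forces \<open>Re (G z) > 0\<close> on this domain, and
  \<open>|G z| \<le> 1 / |z|\<close> on the imaginary axis. The remaining \<open>z\<close> follow by continuity and oddness.
  Applied to real \<open>\<lambda> > \<rho>\<close>, the functional equation gives \<open>\<lambda> = \<Phi>(G(\<lambda>)) / G(\<lambda>)\<close>, so
  \<open>\<rho> \<ge> inf \<Phi>(t) / t\<close>. The minimiser is governed by \<open>t \<Phi>'(t) - \<Phi>(t)\<close>, which is strictly increasing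
  and changes sign because the degree is at least \<open>3\<close>.
\<close>

subsection \<open>Rooted trees\<close>

text \<open>A simple path from \<open>x\<close> to \<open>y\<close> that avoids the edge has length
  at least two, since a one-step path is the edge itself. Closing it with the edge produces a
  cycle.\<close>

lemma tree_bridge:
  assumes tree: "is_tree adj" and xy: "adj x y"
  shows "\<not> (\<lambda>u v. adj u v \<and> {u, v} \<noteq> {x, y})\<^sup>*\<^sup>* x y"
proof
  let ?R = "\<lambda>u v. adj u v \<and> {u, v} \<noteq> {x, y}"
  assume "?R\<^sup>*\<^sup>* x y"
  then obtain xs0 where "rtrancl_path ?R x xs0 y"
    by (auto simp: rtranclp_eq_rtrancl_path)
  then obtain xs where path: "rtrancl_path ?R x xs y" and dist: "distinct (x # xs)"
    by (rule rtrancl_path_distinct)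
  have irr: "\<And>x. \<not> adj x x" and sym: "\<And>u v. adj u v \<Longrightarrow> adj v u"
    using tree by (auto simp: is_tree_def)
  have "x \<noteq> y"
    using xy irr by auto
  have ne: "xs \<noteq> []"
    using path \<open>x \<noteq> y\<close> by (auto elim: rtrancl_path.cases)
  have last: "last xs = y"
    using path ne by (rule rtrancl_path_last)
  have step: "?R ((x # xs) ! i) (xs ! i)" if "i < length xs" for i
    using path that by (rule rtrancl_path_nth)
  have "length xs \<noteq> 1"
  proof
    assume "length xs = 1"
    then have "xs ! 0 = y"
      using last by (metis One_nat_def diff_self_eq_0 last_conv_nth ne)
    then show False
      using step[of 0] \<open>length xs = 1\<close> by simp
  qed
  then have "length xs \<ge> 2"
    using ne by (cases xs; cases "tl xs") auto
  then have "is_cycle adj (x # xs)"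
    using dist step last ne sym[OF xy] by (auto simp: is_cycle_def)
  then show False
    using tree by (auto simp: is_tree_def)
qed

lemma rtranclp_weaken:
  assumes "R\<^sup>*\<^sup>* x y" and "\<And>u v. R u v \<Longrightarrow> S u v"
  shows "S\<^sup>*\<^sup>* x y"
  using rtranclp_mono[of R S] assms by blast

text \<open>\<open>d\<close> is the distance from \<open>r\<close>, and \<open>par\<close> picks a
  neighbour one step closer. Acyclicity enters through the last clause: the ends of an edge not of
  parent type could be joined through the root without using that edge, against
  \<open>tree_bridge\<close>.\<close>

lemma tree_rooted:
  assumes tree: "is_tree adj"
  obtains d :: "'v \<Rightarrow> nat" and par :: "'v \<Rightarrow> 'v"
  where "d r = 0"
    and "\<And>x. x \<noteq> r \<Longrightarrow> adj x (par x)"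
    and "\<And>x. x \<noteq> r \<Longrightarrow> d x = Suc (d (par x))"
    and "\<And>x y. adj x y \<Longrightarrow> (y \<noteq> r \<and> x = par y) \<or> (x \<noteq> r \<and> y = par x)"
proof -
  have irr: "\<And>x. \<not> adj x x" and sym: "\<And>u v. adj u v \<Longrightarrow> adj v u"
    and conn: "\<And>x y. adj\<^sup>*\<^sup>* x y"
    using tree by (auto simp: is_tree_def)
  define d where "d x = (LEAST n. (adj ^^ n) r x)" for x
  have dw: "(adj ^^ d x) r x" for x
    unfolding d_def using conn[of r x, unfolded rtranclp_power] by (rule LeastI_ex)
  have dle: "d x \<le> n" if "(adj ^^ n) r x" for x n
    unfolding d_def using that by (rule Least_le)
  have d0: "d r = 0"
    using dle[of 0 r] by simp
  have d0D: "x = r" if "d x = 0" for x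
    using dw[of x] that by simp
  have dstep: "d y \<le> Suc (d x)" if "adj x y" for x y
    using dw[of x] that by (intro dle) auto
  have pred: "\<exists>z. adj z x \<and> d x = Suc (d z)" if ne: "x \<noteq> r" for x
  proof -
    obtain n where n: "d x = Suc n"
      using d0D ne by (cases "d x") auto
    then obtain z where z: "(adj ^^ n) r z" "adj z x"
      using dw[of x] by auto
    then have "d z = n"
      using dle[OF z(1)] dstep[OF z(2)] n by simp
    then show ?thesis
      using z n by auto
  qed
  define par where "par x = (SOME z. adj z x \<and> d x = Suc (d z))" for x
  have par: "adj (par x) x" "d x = Suc (d (par x))" if "x \<noteq> r" for x
    using someI_ex[OF pred[OF that]] by (auto simp: par_def)
  \<comment> \<open>Recording that the depth strictly increases and never exceeds \<open>d x\<close>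
    is what later shows that these paths miss a given edge.\<close>
  have up: "(\<lambda>u v. adj u v \<and> d u < d v \<and> d v \<le> d x)\<^sup>*\<^sup>* r x" for x
  proof (induction "d x" arbitrary: x)
    case 0
    then show ?case using d0D by simp
  next
    case (Suc n)
    then have "x \<noteq> r"
      using d0 by auto
    note p = par[OF this]
    have "(\<lambda>u v. adj u v \<and> d u < d v \<and> d v \<le> d (par x))\<^sup>*\<^sup>* r (par x)"
      using Suc p by auto
    then have "(\<lambda>u v. adj u v \<and> d u < d v \<and> d v \<le> d x)\<^sup>*\<^sup>* r (par x)"
      by (rule rtranclp_weaken) (use p in auto)
    moreover have "adj (par x) x \<and> d (par x) < d x \<and> d x \<le> d x"
      using p by linarith
    ultimately show ?case
      by (rule rtranclp.rtrancl_into_rtrancl)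
  qed
  have unique: "x = par y \<and> y \<noteq> r" if xy: "adj x y" and le: "d x \<le> d y" for x y
  proof -
    have yr: "y \<noteq> r"
      using le d0 d0D[of x] irr[of x] xy by (metis le_zero_eq)
    note p = par[OF yr]
    have "x = par y"
    proof (rule ccontr)
      assume ne: "x \<noteq> par y"
      let ?R = "\<lambda>u v. adj u v \<and> {u, v} \<noteq> {x, y}"
      have "x \<noteq> y"
        using xy irr by auto
      have rx: "?R\<^sup>*\<^sup>* r x"
        by (rule rtranclp_weaken[OF up[of x]])
           (use le \<open>x \<noteq> y\<close> in \<open>auto simp: doubleton_eq_iff\<close>)
      have "?R\<^sup>*\<^sup>* r (par y)"
        by (rule rtranclp_weaken[OF up[of "par y"]])
           (use p in \<open>auto simp: doubleton_eq_iff\<close>)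
      then have ry: "?R\<^sup>*\<^sup>* r y"
        by (rule rtranclp.rtrancl_into_rtrancl) (use p ne \<open>x \<noteq> y\<close> in \<open>auto simp: doubleton_eq_iff\<close>)
      have "symp ?R"
        using sym by (auto simp: symp_def insert_commute)
      then have "?R\<^sup>*\<^sup>* x r"
        using rx by (metis (no_types, lifting) symp_rtranclp sympD)
      then have "?R\<^sup>*\<^sup>* x y"
        using ry by (rule rtranclp_trans)
      then show False
        using tree_bridge[OF tree xy] by simp
    qed
    then show ?thesis using yr by simp
  qed
  show ?thesis
  proof (rule that[of d par])
    show "(y \<noteq> r \<and> x = par y) \<or> (x \<noteq> r \<and> y = par x)" if "adj x y" for x y
      using unique[OF that] unique[OF sym[OF that]] by (cases "d x \<le> d y") auto
  qed (use d0 par sym in auto)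
qed

text \<open>One construction for two objects: the reversing measure and the superharmonic function
  are both products of edge weights along the path to the root.\<close>

lemma geodesic_product:
  fixes d :: "'v \<Rightarrow> nat" and h :: "'v \<Rightarrow> 'v \<Rightarrow> 'a :: comm_monoid_mult"
  assumes "d r = 0" and "\<And>x. x \<noteq> r \<Longrightarrow> d x = Suc (d (par x))"
  obtains g where "g r = 1" and "\<And>x. x \<noteq> r \<Longrightarrow> g x = h x (par x) * g (par x)"
proof
  define g where "g x = (\<Prod>i<d x. h ((par ^^ i) x) ((par ^^ Suc i) x))" for x
  show "g r = 1"
    by (simp add: g_def assms)
  show "g x = h x (par x) * g (par x)" if "x \<noteq> r" for x
    unfolding g_def assms(2)[OF that] prod.lessThan_Suc_shift
    by (simp add: funpow_swap1)
qed

subsection \<open>Markov kernels\<close>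

lemma has_sum_weighted_bounded:
  fixes a :: "'a \<Rightarrow> real" and f :: "'a \<Rightarrow> real"
  assumes a: "(a has_sum s) A" "\<And>x. a x \<ge> 0" and f: "\<And>x. \<bar>f x\<bar> \<le> B"
  shows "(\<lambda>x. a x * f x) summable_on A" and "\<bar>\<Sum>\<^sub>\<infinity>x\<in>A. a x * f x\<bar> \<le> s * B"
proof -
  have sum: "((\<lambda>x. a x * B) has_sum (s * B)) A"
    using a(1) by (rule has_sum_cmult_left)
  have le: "norm (a x * f x) \<le> a x * B" for x
    using a(2)[of x] f[of x] by (simp add: abs_mult mult_left_mono)
  then have "(\<lambda>x. norm (a x * f x)) summable_on A"
    using sum by (intro Infinite_Sum.abs_summable_on_comparison_test'[where g = "\<lambda>x. a x * B" and f = "\<lambda>x. a x * f x"]) (auto simp: summable_on_def)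
  then show "(\<lambda>x. a x * f x) summable_on A"
    by (rule abs_summable_summable)
  have "norm (\<Sum>\<^sub>\<infinity>x\<in>A. a x * f x) \<le> s * B"
    by (rule norm_infsum_le[OF has_sum_infsum sum])
       (use le \<open>(\<lambda>x. a x * f x) summable_on A\<close> in auto)
  then show "\<bar>\<Sum>\<^sub>\<infinity>x\<in>A. a x * f x\<bar> \<le> s * B"
    by simp
qed

lemma has_sum_finite_sum:
  fixes f :: "'i \<Rightarrow> 'a \<Rightarrow> 'b::topological_comm_monoid_add"
  assumes "\<And>i. i \<in> I \<Longrightarrow> (f i has_sum S i) A"
  shows "((\<lambda>x. \<Sum>i\<in>I. f i x) has_sum (\<Sum>i\<in>I. S i)) A"
  using assms by (induction I rule: infinite_finite_induct) (auto intro: has_sum_add)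

text \<open>All terms are nonnegative, and bounded inner sums weighted by a row of finite mass make
  the double family summable; this justifies exchanging the two sums.\<close>

lemma has_sum_kernel_compose:
  fixes a :: "'a \<Rightarrow> real" and b :: "'a \<Rightarrow> 'b \<Rightarrow> real"
  assumes a: "(a has_sum s) UNIV" "\<And>w. a w \<ge> 0"
    and b: "\<And>w. (b w has_sum 1) UNIV" "\<And>w z. b w z \<ge> 0"
    and f: "\<And>z. f z \<ge> 0" "\<And>z. f z \<le> B"
  shows "((\<lambda>z. (\<Sum>\<^sub>\<infinity>w. a w * b w z) * f z) has_sum (\<Sum>\<^sub>\<infinity>w. a w * (\<Sum>\<^sub>\<infinity>z. b w z * f z))) UNIV"
proof -
  define F where "F = (\<lambda>(w, z). a w * (b w z * f z))"
  define g where "g w = a w * (\<Sum>\<^sub>\<infinity>z. b w z * f z)" for w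
  have fB: "\<bar>f z\<bar> \<le> B" for z
    using f by simp
  have b1: "b w z \<le> 1" for w z
    using has_sum_mono2[of "b w" "{z}" "b w z" UNIV 1] b by (auto simp: has_sum_finite_iff)
  have inner: "((\<lambda>z. F (w, z)) has_sum g w) UNIV" for w
    unfolding F_def g_def
    using has_sum_weighted_bounded(1)[OF b fB, of w]
    by (auto intro: has_sum_cmult_right)
  have B2: "\<bar>\<Sum>\<^sub>\<infinity>z. b w z * f z\<bar> \<le> 1 * B" for w
    by (rule has_sum_weighted_bounded(2)[OF b fB])
  have g: "g summable_on UNIV"
    unfolding g_def by (rule has_sum_weighted_bounded(1)[OF a B2])
  have F: "F summable_on UNIV \<times> UNIV"
    by (rule summable_on_SigmaI[OF inner g]) (use a b f in \<open>auto simp: F_def\<close>)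
  have "(F has_sum (\<Sum>\<^sub>\<infinity>w. g w)) (UNIV \<times> UNIV)"
    by (rule has_sum_SigmaI[OF inner _ F]) (use g in auto)
  then have swapped: "((\<lambda>(z, w). F (w, z)) has_sum (\<Sum>\<^sub>\<infinity>w. g w)) (UNIV \<times> UNIV)"
    by (subst (asm) has_sum_swap) simp
  have col: "((\<lambda>w. F (w, z)) has_sum ((\<Sum>\<^sub>\<infinity>w. a w * b w z) * f z)) UNIV" for z
  proof -
    have "(\<lambda>w. a w * b w z) summable_on UNIV"
      by (rule has_sum_weighted_bounded(1)[OF a, where B = 1]) (use b b1 in auto)
    then have "((\<lambda>w. a w * b w z * f z) has_sum ((\<Sum>\<^sub>\<infinity>w. a w * b w z) * f z)) UNIV"
      by (intro has_sum_cmult_left) auto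
    then show ?thesis
      by (simp add: F_def mult.assoc)
  qed
  show ?thesis
    using has_sum_SigmaD[OF swapped, of "\<lambda>z. (\<Sum>\<^sub>\<infinity>w. a w * b w z) * f z"] col
    by (simp add: g_def)
qed

locale markov_kernel =
  fixes p :: "'v \<Rightarrow> 'v \<Rightarrow> real"
  assumes p_nonneg: "\<And>x y. p x y \<ge> 0"
    and p_row: "\<And>x. (p x has_sum 1) UNIV"
begin

lemmas summable_p = has_sum_weighted_bounded(1)[OF p_row p_nonneg]
lemmas abs_infsum_p_le = has_sum_weighted_bounded(2)[OF p_row p_nonneg, simplified]

lemma p_le_1: "p x y \<le> 1"
  using has_sum_mono2[of "p x" "{y}" "p x y" UNIV 1] p_row p_nonneg
  by (auto simp: has_sum_finite_iff)

lemma nstep_nonneg: "nstep p n x y \<ge> 0"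
  by (induction n arbitrary: x) (auto intro!: infsum_nonneg simp: p_nonneg)

lemma nstep_row: "(nstep p n x has_sum 1) UNIV"
proof (induction n arbitrary: x)
  case 0
  show ?case
    by (rule has_sum_finite_neutralI[of "{x}"]) auto
next
  case (Suc n)
  have "((\<lambda>z. (\<Sum>\<^sub>\<infinity>w. p x w * nstep p n w z) * 1) has_sum
      (\<Sum>\<^sub>\<infinity>w. p x w * (\<Sum>\<^sub>\<infinity>z. nstep p n w z * 1))) UNIV"
    by (rule has_sum_kernel_compose[OF p_row p_nonneg Suc nstep_nonneg]) auto
  moreover have "(\<Sum>\<^sub>\<infinity>z. nstep p n w z) = 1" for w
    using Suc by (rule infsumI)
  moreover have "(\<Sum>\<^sub>\<infinity>w. p x w) = 1"
    using p_row by (rule infsumI)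
  ultimately show ?case
    by simp
qed

lemma nstep_le_1: "nstep p n x y \<le> 1"
  using has_sum_mono2[of "nstep p n x" "{y}" "nstep p n x y" UNIV 1] nstep_row nstep_nonneg
  by (auto simp: has_sum_finite_iff)

lemma abs_nstep_le_1: "\<bar>nstep p n x y\<bar> \<le> 1"
  using nstep_nonneg[of n x y] nstep_le_1[of n x y] by simp

lemma chapman_kolmogorov:
  "((\<lambda>z. nstep p m x z * nstep p n z y) has_sum nstep p (m + n) x y) UNIV"
proof (induction m arbitrary: x)
  case 0
  show ?case
    by (rule has_sum_finite_neutralI[of "{x}"]) auto
next
  case (Suc m)
  have "((\<lambda>z. (\<Sum>\<^sub>\<infinity>w. p x w * nstep p m w z) * nstep p n z y) has_sum
      (\<Sum>\<^sub>\<infinity>w. p x w * (\<Sum>\<^sub>\<infinity>z. nstep p m w z * nstep p n z y))) UNIV"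
    by (rule has_sum_kernel_compose[OF p_row p_nonneg nstep_row nstep_nonneg nstep_nonneg nstep_le_1])
  moreover have "(\<Sum>\<^sub>\<infinity>z. nstep p m w z * nstep p n z y) = nstep p (m + n) w y" for w
    using Suc by (rule infsumI)
  ultimately show ?case
    by simp
qed

lemma nstep_1: "nstep p (Suc 0) x y = p x y"
proof -
  have "((\<lambda>z. p x z * (if z = y then 1 else 0)) has_sum p x y) UNIV"
    by (rule has_sum_finite_neutralI[of "{y}"]) auto
  then show ?thesis
    by (simp add: infsumI)
qed

text \<open>\<open>nstep\<close> peels off the first step of a path, while the reversed path has to
  lose its last one. The induction therefore uses \<open>chapman_kolmogorov\<close> with a final
  single step.\<close>

lemma nstep_reversible:
  assumes m: "\<And>x y. m x * p x y = m y * p y x"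
  shows "m x * nstep p n x y = m y * nstep p n y x"
proof (induction n arbitrary: x)
  case 0
  show ?case by simp
next
  case (Suc n)
  have "((\<lambda>z. m y * (nstep p n y z * nstep p (Suc 0) z x)) has_sum m y * nstep p (n + Suc 0) y x) UNIV"
    by (intro has_sum_cmult_right chapman_kolmogorov)
  moreover have "m y * (nstep p n y z * nstep p (Suc 0) z x) = m x * (p x z * nstep p n z y)" for z
    using arg_cong[OF m[of z x], of "\<lambda>t. nstep p n z y * t"] arg_cong[OF Suc[of z], of "\<lambda>t. t * p z x"]
    unfolding nstep_1 by (simp only: mult_ac)
  ultimately have "((\<lambda>z. m x * (p x z * nstep p n z y)) has_sum m y * nstep p (Suc n) y x) UNIV"
    by (simp only: add_Suc_right add_0_right)
  moreover have "((\<lambda>z. m x * (p x z * nstep p n z y)) has_sum m x * nstep p (Suc n) x y) UNIV"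
    using summable_p[of "\<lambda>z. nstep p n z y" 1 x] abs_nstep_le_1
    by (auto intro!: has_sum_cmult_right)
  ultimately show ?case
    by (metis has_sum_unique)
qed

text \<open>Only the parity of \<open>d\<close> matters: it is a two-colouring that every step
  flips.\<close>

lemma nstep_parity:
  assumes d: "\<And>x y. p x y \<noteq> 0 \<Longrightarrow> even (d x) \<longleftrightarrow> odd (d y :: nat)"
    and "nstep p n x y \<noteq> 0"
  shows "even (n + d x + d y)"
  using assms(2)
proof (induction n arbitrary: x)
  case 0
  then show ?case by (auto split: if_splits)
next
  case (Suc n)
  then obtain z where "p x z * nstep p n z y \<noteq> 0"
    by (metis (no_types, lifting) infsum_0 nstep.simps(2))
  then show ?case
    using Suc.IH[of z] d[of x z] by auto
qed

lemma nstep_supersolution: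
  assumes g: "\<And>x. g x \<ge> 0" "\<And>x. (\<lambda>z. p x z * g z) summable_on UNIV"
    and super: "\<And>x. (\<Sum>\<^sub>\<infinity>z. p x z * g z) \<le> l * g x" and "l \<ge> 0"
  shows "nstep p n x y * g y \<le> l ^ n * g x"
proof (induction n arbitrary: x)
  case 0
  show ?case using g by simp
next
  case (Suc n)
  have "nstep p (Suc n) x y * g y = (\<Sum>\<^sub>\<infinity>z. p x z * (nstep p n z y * g y))"
    by (simp add: infsum_cmult_left' mult.assoc[symmetric])
  also have "\<dots> \<le> (\<Sum>\<^sub>\<infinity>z. p x z * (l ^ n * g z))"
  proof (rule infsum_mono)
    show "(\<lambda>z. p x z * (nstep p n z y * g y)) summable_on UNIV"
      using summable_on_cmult_left[OF summable_p[of "\<lambda>z. nstep p n z y" 1 x], of "g y"] abs_nstep_le_1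
      by (simp add: mult.assoc)
    show "(\<lambda>z. p x z * (l ^ n * g z)) summable_on UNIV"
      using summable_on_cmult_right[OF g(2)[of x], of "l ^ n"] by (simp add: mult_ac)
    show "p x z * (nstep p n z y * g y) \<le> p x z * (l ^ n * g z)" for z
      by (intro mult_left_mono Suc p_nonneg)
  qed
  also have "\<dots> = l ^ n * (\<Sum>\<^sub>\<infinity>z. p x z * g z)"
    by (simp add: infsum_cmult_right'[symmetric] mult_ac)
  also have "\<dots> \<le> l ^ n * (l * g x)"
    by (intro mult_left_mono super) (use \<open>l \<ge> 0\<close> in auto)
  finally show ?case
    by (simp add: mult_ac)
qed

text \<open>\<open>P\<close> does not increase sup norms, so for \<open>l > 1\<close> the operator
  \<open>l - P\<close> is injective on bounded functions and a bounded solution must be the Neumann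
  series.\<close>

lemma resolvent_sums:
  assumes h: "\<And>x. \<bar>h x\<bar> \<le> B" and "l > 1"
    and eq: "\<And>x. l * h x - (\<Sum>\<^sub>\<infinity>z. p x z * h z) = (if x = y then 1 else 0)"
  shows "(\<lambda>n. nstep p n x y / l ^ Suc n) sums h x"
proof -
  define S where "S N x = (\<Sum>n<N. nstep p n x y / l ^ Suc n)" for N x
  have Sbound: "\<bar>S N z\<bar> \<le> real N" for N z
  proof -
    have "\<bar>S N z\<bar> \<le> (\<Sum>n<N. \<bar>nstep p n z y / l ^ Suc n\<bar>)"
      unfolding S_def by (rule sum_abs)
    also have "\<dots> \<le> (\<Sum>n<N. 1)"
    proof (rule sum_mono)
      fix n
      have "\<bar>nstep p n z y / l ^ Suc n\<bar> = nstep p n z y / l ^ Suc n"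
        using nstep_nonneg[of n z y] \<open>l > 1\<close> by simp
      also have "\<dots> \<le> 1 / 1"
        using \<open>l > 1\<close> by (intro frac_le nstep_le_1 one_le_power) auto
      finally show "\<bar>nstep p n z y / l ^ Suc n\<bar> \<le> 1" by simp
    qed
    finally show ?thesis by simp
  qed
  \<comment> \<open>The error \<open>e_N = h - S N\<close> satisfies
    \<open>P e_N = l e_(N+1)\<close>, so each further term of the series gains a factor
    \<open>1 / l\<close>.\<close>
  have err: "\<bar>h x - S N x\<bar> \<le> B / l ^ N" for N x
  proof (induction N arbitrary: x)
    case 0
    show ?case using h by (simp add: S_def)
  next
    case (Suc N)
    have sumS: "((\<lambda>z. p x z * S N z) has_sum (\<Sum>n<N. nstep p (Suc n) x y / l ^ Suc n)) UNIV"
    proof -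
      have "((\<lambda>z. \<Sum>n<N. p x z * nstep p n z y / l ^ Suc n) has_sum
          (\<Sum>n<N. nstep p (Suc n) x y / l ^ Suc n)) UNIV"
      proof (rule has_sum_finite_sum)
        fix n
        have "((\<lambda>z. p x z * nstep p n z y) has_sum nstep p (Suc n) x y) UNIV"
          using summable_p[of "\<lambda>z. nstep p n z y" 1 x] abs_nstep_le_1 by simp
        then show "((\<lambda>z. p x z * nstep p n z y / l ^ Suc n) has_sum nstep p (Suc n) x y / l ^ Suc n) UNIV"
          by (rule has_sum_divide_const)
      qed
      then show ?thesis
        by (simp add: S_def sum_distrib_left mult.assoc)
    qed
    have sumh: "((\<lambda>z. p x z * h z) has_sum (l * h x - (if x = y then 1 else 0))) UNIV"
      using summable_p[of h B x] h eq[of x] by (simp add: has_sum_iff)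
    have diff: "((\<lambda>z. p x z * (h z - S N z)) has_sum
        (l * h x - (if x = y then 1 else 0) - (\<Sum>n<N. nstep p (Suc n) x y / l ^ Suc n))) UNIV"
      using has_sum_add[OF sumh has_sum_uminusI[OF sumS]] by (simp add: algebra_simps)
    have "S (Suc N) x = (if x = y then 1 else 0) / l + (\<Sum>n<N. nstep p (Suc n) x y / l ^ Suc n) / l"
      unfolding S_def sum.lessThan_Suc_shift by (simp add: sum_divide_distrib mult_ac del: nstep.simps(2))
    then have "l * h x - (if x = y then 1 else 0) - (\<Sum>n<N. nstep p (Suc n) x y / l ^ Suc n)
        = l * (h x - S (Suc N) x)"
      using \<open>l > 1\<close> by (simp add: field_simps)
    with diff have "(\<Sum>\<^sub>\<infinity>z. p x z * (h z - S N z)) = l * (h x - S (Suc N) x)"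
      by (simp add: infsumI)
    moreover have "\<bar>\<Sum>\<^sub>\<infinity>z. p x z * (h z - S N z)\<bar> \<le> B / l ^ N"
      using abs_infsum_p_le[of "\<lambda>z. h z - S N z" "B / l ^ N" x] Suc by simp
    ultimately have "l * \<bar>h x - S (Suc N) x\<bar> \<le> B / l ^ N"
      using \<open>l > 1\<close> by (simp add: abs_mult)
    then show ?case
      using \<open>l > 1\<close> by (simp add: field_simps)
  qed
  have "(\<lambda>N. B / l ^ N) \<longlonglongrightarrow> 0"
    using LIMSEQ_divide_realpow_zero[OF \<open>l > 1\<close>] by simp
  then have "(\<lambda>N. h x - S N x) \<longlonglongrightarrow> 0"
    by (rule Lim_null_comparison[rotated]) (use err in auto)
  then have "(\<lambda>N. h x - (h x - S N x)) \<longlonglongrightarrow> h x - 0"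
    by (intro tendsto_intros)
  then show ?thesis
    by (simp add: sums_def S_def)
qed

end

subsection \<open>Hankel positivity\<close>

text \<open>Log-convexity of \<open>s\<close> makes its consecutive ratios increase, so the first one is at most
  the growth rate.\<close>

lemma log_convex_first_ratio:
  fixes s :: "nat \<Rightarrow> real"
  assumes "s 0 \<ge> 0"
    and convex: "\<And>k y. 0 \<le> s k - 2 * y * s (Suc k) + y\<^sup>2 * s (Suc (Suc k))"
    and growth: "\<And>k. s k \<le> C * h ^ k" and "h \<ge> 0"
  shows "s (Suc 0) \<le> h * s 0"
proof (rule ccontr)
  assume "\<not> ?thesis"
  then have gt: "h * s 0 < s (Suc 0)"
    by simp
  \<comment> \<open>\<open>h\<close> can be enlarged slightly without losing the strict inequality.
    The increment \<open>e\<close> uses up at most half of the gap; the \<open>+ 1\<close> in its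
    denominator covers the case \<open>s 0 = 0\<close>.\<close>
  obtain q where q: "q > h" "q * s 0 < s (Suc 0)"
  proof -
    define e where "e = (s (Suc 0) - h * s 0) / (2 * (s 0 + 1))"
    have "e > 0"
      using gt \<open>s 0 \<ge> 0\<close> by (simp add: e_def)
    have "e * s 0 \<le> e * (s 0 + 1)"
      using \<open>e > 0\<close> by simp
    also have "\<dots> = (s (Suc 0) - h * s 0) / 2"
      using \<open>s 0 \<ge> 0\<close> by (simp add: e_def field_simps)
    finally have "(h + e) * s 0 < s (Suc 0)"
      using gt by (simp add: algebra_simps)
    with \<open>e > 0\<close> show ?thesis
      by (intro that[of "h + e"]) auto
  qed
  have "q > 0"
    using q \<open>h \<ge> 0\<close> by simp
  have s1: "s (Suc 0) > 0"
    using q(2) mult_nonneg_nonneg[of q "s 0"] \<open>q > 0\<close> \<open>s 0 \<ge> 0\<close> by linarith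
  have ratio: "q * s k \<le> s (Suc k)" for k
  proof (induction k)
    case 0
    show ?case using q by simp
  next
    case (Suc k)
    \<comment> \<open>The quadratic inequality is evaluated at \<open>y = 1 / q\<close>, where the
      induction hypothesis turns it into the next ratio bound.\<close>
    have "0 \<le> q\<^sup>2 * (s k - 2 * (1 / q) * s (Suc k) + (1 / q)\<^sup>2 * s (Suc (Suc k)))"
      using convex[of k "1 / q"] by simp
    also have "\<dots> = q * (q * s k) - 2 * q * s (Suc k) + s (Suc (Suc k))"
      using \<open>q > 0\<close> by (simp add: field_simps power2_eq_square)
    also have "\<dots> \<le> q * s (Suc k) - 2 * q * s (Suc k) + s (Suc (Suc k))"
      using Suc \<open>q > 0\<close> by simp
    finally show ?case by simp
  qed
  have low: "s (Suc 0) * q ^ k \<le> s (Suc k)" for k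
  proof (induction k)
    case (Suc k)
    have "s (Suc 0) * q ^ Suc k = q * (s (Suc 0) * q ^ k)"
      by simp
    also have "\<dots> \<le> q * s (Suc k)"
      using Suc \<open>q > 0\<close> by simp
    also have "\<dots> \<le> s (Suc (Suc k))"
      by (rule ratio)
    finally show ?case .
  qed simp
  have "s (Suc 0) \<le> C * h * (h / q) ^ k" for k
  proof -
    have "s (Suc 0) * q ^ k \<le> C * h ^ Suc k"
      using low[of k] growth[of "Suc k"] by simp
    then show ?thesis
      using \<open>q > 0\<close> by (simp add: field_simps power_divide)
  qed
  moreover have "(\<lambda>k. C * h * (h / q) ^ k) \<longlonglongrightarrow> C * h * 0"
    using q \<open>q > 0\<close> \<open>h \<ge> 0\<close> by (intro tendsto_intros LIMSEQ_power_zero) auto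
  ultimately have "s (Suc 0) \<le> C * h * 0"
    by (meson LIMSEQ_le_const)
  with s1 show False by simp
qed

text \<open>The model is a symmetric operator \<open>P\<close>: \<open>v i\<close> encodes
  \<open>P^i\<close> applied to the indicator of \<open>o'\<close>, \<open>w\<close> is the weight
  of the inner product, and \<open>moment\<close> says that the Gram matrix of the iterates is the
  Hankel matrix of \<open>A\<close>.\<close>

locale moments =
  fixes A :: "nat \<Rightarrow> real" and v :: "nat \<Rightarrow> 'v \<Rightarrow> real" and w :: "'v \<Rightarrow> real" and o' :: 'v
  assumes w_nonneg: "\<And>x. w x \<ge> 0"
    and moment: "\<And>i j. ((\<lambda>x. w x * (v i x * v j x)) has_sum A (i + j)) UNIV"
    and w_o: "w o' = 1" and v_o: "\<And>i. v i o' = A i"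
begin

context
  fixes c :: "nat \<Rightarrow> complex" and N :: nat
begin

text \<open>With \<open>f\<close> the combination of the even iterates \<open>P^(2 i)\<close> with
  coefficients \<open>c i\<close>, \<open>comb k\<close> encodes \<open>P^k f\<close>, and
  \<open>form n\<close> is the inner product of \<open>P^n f\<close> with \<open>f\<close>. Even
  powers suffice because the odd part of the resolvent is \<open>P / z\<close> applied to its even
  part.\<close>

definition comb :: "nat \<Rightarrow> 'v \<Rightarrow> complex" where
  "comb k x = (\<Sum>i<N. c i * of_real (v (2 * i + k) x))"

definition form :: "nat \<Rightarrow> complex" where
  "form n = (\<Sum>i<N. \<Sum>j<N. c i * cnj (c j) * of_real (A (2 * i + 2 * j + n)))"

lemma has_sum_comb:
  "((\<lambda>x. of_real (w x) * (comb k x * cnj (comb l x))) has_sum form (k + l)) UNIV"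
proof -
  have "((\<lambda>x. \<Sum>i<N. \<Sum>j<N. c i * cnj (c j) * of_real (w x * (v (2 * i + k) x * v (2 * j + l) x))) has_sum
      (\<Sum>i<N. \<Sum>j<N. c i * cnj (c j) * of_real (A ((2 * i + k) + (2 * j + l))))) UNIV"
    by (intro has_sum_finite_sum has_sum_cmult_right has_sum_of_real moment)
  moreover have "(\<Sum>i<N. \<Sum>j<N. c i * cnj (c j) * of_real (w x * (v (2 * i + k) x * v (2 * j + l) x)))
      = of_real (w x) * (comb k x * cnj (comb l x))" for x
    unfolding comb_def cnj_sum sum_product unfolding sum_distrib_left
    by (intro sum.cong refl) (simp add: mult_ac)
  ultimately show ?thesis
    by (simp add: form_def add_ac)
qed

lemma cnj_form: "cnj (form n) = form n"
proof -
  have "cnj (form n) = (\<Sum>i<N. \<Sum>j<N. c j * cnj (c i) * of_real (A (2 * j + 2 * i + n)))"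
    unfolding form_def cnj_sum by (intro sum.cong refl) (simp add: mult_ac add_ac)
  also have "\<dots> = form n"
    unfolding form_def by (rule sum.swap)
  finally show ?thesis .
qed

lemma form_eq_Re: "form n = of_real (Re (form n))"
  using cnj_form[of n] by (simp add: complex_eq_iff)

lemma has_sum_Re_comb:
  "((\<lambda>x. w x * Re (comb k x * cnj (comb l x))) has_sum Re (form (k + l))) UNIV"
  using has_sum_Re[OF has_sum_comb[of k l]] by simp

lemma form_even_nonneg: "Re (form (k + k)) \<ge> 0"
  by (rule has_sum_nonneg[OF has_sum_Re_comb]) (simp add: w_nonneg complex_mult_cnj)

lemma form_convex:
  "0 \<le> Re (form (k + k)) - 2 * y * Re (form (k + l)) + y\<^sup>2 * Re (form (l + l))"
proof (rule has_sum_nonneg)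
  show "((\<lambda>x. w x * (cmod (comb k x - of_real y * comb l x))\<^sup>2) has_sum
     (Re (form (k + k)) - 2 * y * Re (form (k + l)) + y\<^sup>2 * Re (form (l + l)))) UNIV"
  proof -
    have "((\<lambda>x. w x * Re (comb k x * cnj (comb k x)) + - (2 * y) * (w x * Re (comb k x * cnj (comb l x)))
        + y\<^sup>2 * (w x * Re (comb l x * cnj (comb l x)))) has_sum
     (Re (form (k + k)) + - (2 * y) * Re (form (k + l)) + y\<^sup>2 * Re (form (l + l)))) UNIV"
      by (intro has_sum_add has_sum_cmult_right has_sum_Re_comb)
    moreover have "w x * Re (comb k x * cnj (comb k x)) + - (2 * y) * (w x * Re (comb k x * cnj (comb l x)))
        + y\<^sup>2 * (w x * Re (comb l x * cnj (comb l x))) = w x * (cmod (comb k x - of_real y * comb l x))\<^sup>2" for x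
      unfolding cmod_power2 by (simp add: power2_eq_square algebra_simps)
    ultimately show ?thesis by simp
  qed
qed (simp add: w_nonneg)

lemma form_growth:
  assumes growth: "\<And>n. \<bar>A n\<bar> \<le> C * r ^ n" and "r \<ge> 0"
  obtains C' where "\<And>n. Re (form n) \<le> C' * r ^ n"
proof
  fix n
  have "Re (form n) \<le> cmod (form n)"
    by (rule complex_Re_le_cmod)
  also have "\<dots> \<le> (\<Sum>i<N. \<Sum>j<N. cmod (c i * cnj (c j) * of_real (A (2 * i + 2 * j + n))))"
    unfolding form_def by (intro order_trans[OF norm_sum] sum_mono norm_sum)
  also have "\<dots> \<le> (\<Sum>i<N. \<Sum>j<N. cmod (c i) * cmod (c j) * (C * r ^ (2 * i + 2 * j + n)))"
    by (intro sum_mono) (auto simp: norm_mult intro!: mult_left_mono growth)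
  also have "\<dots> = (\<Sum>i<N. \<Sum>j<N. cmod (c i) * cmod (c j) * (C * r ^ (2 * i + 2 * j))) * r ^ n"
    unfolding sum_distrib_right by (intro sum.cong refl) (simp add: power_add mult_ac)
  finally show "Re (form n) \<le> (\<Sum>i<N. \<Sum>j<N. cmod (c i) * cmod (c j) * (C * r ^ (2 * i + 2 * j))) * r ^ n" .
qed

text \<open>The numbers \<open>||P^k f||^2\<close> are log-convex in \<open>k\<close> and grow at
  rate at most \<open>r^2\<close>, so already their first ratio is at most
  \<open>r^2\<close>.\<close>

lemma form_contraction:
  assumes growth: "\<And>n. \<bar>A n\<bar> \<le> C * r ^ n" and "r \<ge> 0"
  shows "Re (form 2) \<le> r\<^sup>2 * Re (form 0)"
proof -
  obtain C' where C': "\<And>n. Re (form n) \<le> C' * r ^ n"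
    using form_growth[OF assms] by blast
  define s where "s k = Re (form (2 * k))" for k
  have "s (Suc 0) \<le> r\<^sup>2 * s 0"
  proof (rule log_convex_first_ratio)
    show "s 0 \<ge> 0"
      using form_even_nonneg[of 0] by (simp add: s_def)
    show "0 \<le> s k - 2 * y * s (Suc k) + y\<^sup>2 * s (Suc (Suc k))" for k y
    proof -
      \<comment> \<open>Pairing \<open>comb k\<close> with \<open>comb (k + 2)\<close> produces the
        exponents \<open>2 k\<close>, \<open>2 k + 2\<close> and \<open>2 k + 4\<close>.\<close>
      have "s k = Re (form (k + k))" "s (Suc k) = Re (form (k + (k + 2)))"
        "s (Suc (Suc k)) = Re (form ((k + 2) + (k + 2)))"
        by (auto simp: s_def intro!: arg_cong[where f = "\<lambda>n. Re (form n)"])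
      then show ?thesis
        using form_convex[of k y "k + 2"] by (simp only:)
    qed
    show "s k \<le> C' * (r\<^sup>2) ^ k" for k
      using C'[of "2 * k"] by (simp add: s_def power_mult)
  qed simp
  then show ?thesis
    by (simp add: s_def numeral_2_eq_2)
qed

text \<open>The left side is the single term at \<open>o'\<close> in the nonnegative sum for
  \<open>||f||^2\<close>.\<close>

lemma form_ge: "(cmod (\<Sum>i<N. c i * of_real (A (2 * i))))\<^sup>2 \<le> Re (form 0)"
proof -
  have "((\<lambda>x. w x * Re (comb 0 x * cnj (comb 0 x))) has_sum w o' * Re (comb 0 o' * cnj (comb 0 o'))) {o'}"
    by (rule has_sum_finiteI[rotated]) auto
  then have "w o' * Re (comb 0 o' * cnj (comb 0 o')) \<le> Re (form (0 + 0))"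
    by (rule has_sum_mono2[OF _ has_sum_Re_comb]) (auto simp: w_nonneg complex_mult_cnj)
  then show ?thesis
    by (simp add: w_o v_o comb_def complex_mult_cnj cmod_power2 del: cnj_sum)
qed

end

section \<open>Energy identity for the resolvent of a moment sequence\<close>

context
  fixes C r :: real and z G :: complex
  assumes growth: "\<And>n. \<bar>A n\<bar> \<le> C * r ^ n" and r: "r \<ge> 0" and z: "cmod z > r"
    and G: "(\<lambda>i. of_real (A (2 * i)) * (1 / z) ^ Suc (2 * i)) sums G"
begin

definition E where "E N = Re (form (\<lambda>i. (1 / z) ^ Suc (2 * i)) N 0)"
definition F where "F N = Re (form (\<lambda>i. (1 / z) ^ Suc (2 * i)) N 2) / (cmod z)\<^sup>2"

text \<open>If \<open>g = (z - P)\<^sup>-\<^sup>1 1\<^sub>o\<close> is split into its parts on the even and the odd vertices, then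
  \<open>E\<close> and \<open>F\<close> approximate the squared norms of the two parts, and the limit below is their
  energy identity.\<close>

lemma energy_identity: "(\<lambda>N. z * of_real (E N) - cnj z * of_real (F N)) \<longlonglongrightarrow> cnj G"
proof -
  define b where "b = 1 / z"
  define q where "q = r * cmod b"
  have z0: "z \<noteq> 0"
    using r z by auto
  have q: "q \<ge> 0" "q < 1"
    using r z z0 by (auto simp: q_def b_def norm_divide)
  have C: "C \<ge> 0"
    using growth[of 0] by simp
  have eq: "z * of_real (E N) - cnj z * of_real (F N)
      = (\<Sum>j<N. of_real (A (2 * j)) * cnj b ^ Suc (2 * j))
       - (\<Sum>j<N. of_real (A (2 * N + 2 * j)) * b ^ (2 * N) * cnj b ^ Suc (2 * j))" for N
  proof -
    \<comment> \<open>These identities turn the prefactors \<open>z\<close> and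
      \<open>cnj z / |z|^2\<close> into powers of \<open>b\<close>, so that the second double sum is
      the first one with \<open>i\<close> shifted by one.\<close>
    have zb: "z * b = 1" "cnj z * (1 / of_real ((cmod z)\<^sup>2)) = b"
      using z0 by (simp_all add: b_def complex_norm_square del: of_real_power)
    have "z * of_real (E N) = (\<Sum>j<N. \<Sum>i<N. of_real (A (2 * i + 2 * j)) * b ^ (2 * i) * cnj b ^ Suc (2 * j))"
    proof -
      have "z * of_real (E N) = z * form (\<lambda>i. b ^ Suc (2 * i)) N 0"
        unfolding E_def b_def by (subst form_eq_Re[symmetric]) simp
      also have "\<dots> = (\<Sum>i<N. \<Sum>j<N. (z * b) * (of_real (A (2 * i + 2 * j)) * b ^ (2 * i) * cnj b ^ Suc (2 * j)))"
        by (simp add: form_def sum_distrib_left mult_ac)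
      also have "\<dots> = (\<Sum>i<N. \<Sum>j<N. of_real (A (2 * i + 2 * j)) * b ^ (2 * i) * cnj b ^ Suc (2 * j))"
        by (simp add: zb)
      also have "\<dots> = (\<Sum>j<N. \<Sum>i<N. of_real (A (2 * i + 2 * j)) * b ^ (2 * i) * cnj b ^ Suc (2 * j))"
        by (rule sum.swap)
      finally show ?thesis .
    qed
    moreover have "cnj z * of_real (F N)
        = (\<Sum>j<N. \<Sum>i<N. of_real (A (2 * Suc i + 2 * j)) * b ^ (2 * Suc i) * cnj b ^ Suc (2 * j))"
    proof -
      have "cnj z * of_real (F N) = (cnj z * (1 / of_real ((cmod z)\<^sup>2))) * form (\<lambda>i. b ^ Suc (2 * i)) N 2"
        unfolding F_def b_def by (subst form_eq_Re) (simp add: field_simps)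
      also have "\<dots> = (\<Sum>i<N. \<Sum>j<N. of_real (A (2 * Suc i + 2 * j)) * b ^ (2 * Suc i) * cnj b ^ Suc (2 * j))"
        unfolding zb by (simp add: form_def sum_distrib_left mult_ac add_ac)
      also have "\<dots> = (\<Sum>j<N. \<Sum>i<N. of_real (A (2 * Suc i + 2 * j)) * b ^ (2 * Suc i) * cnj b ^ Suc (2 * j))"
        by (rule sum.swap)
      finally show ?thesis .
    qed
    ultimately have "z * of_real (E N) - cnj z * of_real (F N)
      = (\<Sum>j<N. \<Sum>i<N. of_real (A (2 * i + 2 * j)) * b ^ (2 * i) * cnj b ^ Suc (2 * j)
           - of_real (A (2 * Suc i + 2 * j)) * b ^ (2 * Suc i) * cnj b ^ Suc (2 * j))"
      by (simp only: sum_subtractf)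
    \<comment> \<open>Telescoping in \<open>i\<close> leaves the terms at \<open>i = 0\<close>,
      which form a partial sum of \<open>cnj G\<close>, and the boundary terms at
      \<open>i = N\<close>, which are shown to vanish in the limit.\<close>
    also have "\<dots> = (\<Sum>j<N. of_real (A (2 * 0 + 2 * j)) * b ^ (2 * 0) * cnj b ^ Suc (2 * j)
           - of_real (A (2 * N + 2 * j)) * b ^ (2 * N) * cnj b ^ Suc (2 * j))"
      by (rule sum.cong[OF refl]) (rule sum_lessThan_telescope')
    also have "\<dots> = (\<Sum>j<N. of_real (A (2 * j)) * cnj b ^ Suc (2 * j))
       - (\<Sum>j<N. of_real (A (2 * N + 2 * j)) * b ^ (2 * N) * cnj b ^ Suc (2 * j))"
      by (simp add: sum_subtractf)
    finally show ?thesis .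
  qed
  have "(\<lambda>N. cnj (\<Sum>i<N. of_real (A (2 * i)) * b ^ Suc (2 * i))) \<longlonglongrightarrow> cnj G"
    using G by (intro tendsto_intros) (simp add: sums_def b_def)
  then have lim1: "(\<lambda>N. \<Sum>j<N. of_real (A (2 * j)) * cnj b ^ Suc (2 * j)) \<longlonglongrightarrow> cnj G"
    by simp
  \<comment> \<open>There are \<open>N\<close> boundary terms, each at most a constant times
    \<open>q^(2 N)\<close> with \<open>q = r / |z| < 1\<close>.\<close>
  have lim2: "(\<lambda>N. \<Sum>j<N. of_real (A (2 * N + 2 * j)) * b ^ (2 * N) * cnj b ^ Suc (2 * j)) \<longlonglongrightarrow> 0"
  proof (rule Lim_null_comparison)
    have "(\<lambda>N. C * cmod b * (of_nat N * (q\<^sup>2) ^ N)) \<longlonglongrightarrow> C * cmod b * 0"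
      using q by (intro tendsto_intros powser_times_n_limit_0) (simp add: power_less_one_iff)
    then show "(\<lambda>N. C * cmod b * (of_nat N * (q\<^sup>2) ^ N)) \<longlonglongrightarrow> 0"
      by simp
    show "\<forall>\<^sub>F N in sequentially. norm (\<Sum>j<N. of_real (A (2 * N + 2 * j)) * b ^ (2 * N) * cnj b ^ Suc (2 * j))
        \<le> C * cmod b * (of_nat N * (q\<^sup>2) ^ N)"
    proof (rule always_eventually, rule allI)
      fix N
      have "norm (\<Sum>j<N. of_real (A (2 * N + 2 * j)) * b ^ (2 * N) * cnj b ^ Suc (2 * j))
          \<le> (\<Sum>j<N. C * cmod b * (q\<^sup>2) ^ N)"
      proof (rule order_trans[OF norm_sum sum_mono])
        fix j
        have "norm (of_real (A (2 * N + 2 * j)) * b ^ (2 * N) * cnj b ^ Suc (2 * j))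
            = \<bar>A (2 * N + 2 * j)\<bar> * cmod b ^ (2 * N + 2 * j) * cmod b"
          by (simp add: norm_mult norm_power power_add)
        also have "\<dots> \<le> (C * r ^ (2 * N + 2 * j)) * cmod b ^ (2 * N + 2 * j) * cmod b"
          by (intro mult_right_mono growth) auto
        also have "\<dots> = C * cmod b * ((q\<^sup>2) ^ N * (q\<^sup>2) ^ j)"
          by (simp add: q_def power_mult_distrib power_add power_mult[symmetric])
        also have "\<dots> \<le> C * cmod b * ((q\<^sup>2) ^ N * 1)"
          using q C by (intro mult_left_mono power_le_one) auto
        finally show "norm (of_real (A (2 * N + 2 * j)) * b ^ (2 * N) * cnj b ^ Suc (2 * j))
            \<le> C * cmod b * (q\<^sup>2) ^ N"
          by simp
      qed
      then show "norm (\<Sum>j<N. of_real (A (2 * N + 2 * j)) * b ^ (2 * N) * cnj b ^ Suc (2 * j))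
        \<le> C * cmod b * (of_nat N * (q\<^sup>2) ^ N)"
        by (simp add: mult_ac)
    qed
  qed
  show ?thesis
    unfolding eq using tendsto_diff[OF lim1 lim2] by simp
qed

lemma F_nonneg: "F N \<ge> 0"
  using form_even_nonneg[of _ N 1] by (simp add: F_def numeral_2_eq_2)

lemma F_le_E: "F N \<le> E N"
proof -
  have E0: "E N \<ge> 0"
    using form_even_nonneg[of _ N 0] by (simp add: E_def)
  have "F N \<le> r\<^sup>2 * E N / (cmod z)\<^sup>2"
    unfolding E_def F_def
    by (intro divide_right_mono form_contraction[OF growth r]) auto
  also have "\<dots> \<le> (cmod z)\<^sup>2 * E N / (cmod z)\<^sup>2"
    using r z E0 by (intro divide_right_mono mult_right_mono power_mono) auto
  also have "\<dots> = E N"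
    using r z by auto
  finally show ?thesis .
qed

text \<open>The real part of the energy identity exhibits \<open>Re G\<close> as the limit of
  \<open>Re z * (E N - F N)\<close>, and the contraction bound makes these terms
  nonnegative.\<close>

lemma Re_resolvent_nonneg:
  assumes "Re z \<ge> 0"
  shows "Re G \<ge> 0"
proof -
  have "(\<lambda>N. Re (z * of_real (E N) - cnj z * of_real (F N))) \<longlonglongrightarrow> Re (cnj G)"
    by (intro tendsto_intros energy_identity)
  moreover have "Re (z * of_real (E N) - cnj z * of_real (F N)) \<ge> 0" for N
    using mult_left_mono[OF F_le_E[of N] assms] by simp
  ultimately have "Re (cnj G) \<ge> 0"
    by (intro LIMSEQ_le_const) auto
  then show ?thesis
    by simp
qed

text \<open>On the imaginary axis \<open>cnj z = - z\<close>, so the two energies add up and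
  \<open>|z| (E N + F N)\<close> tends to \<open>|G|\<close>. Since \<open>E N\<close> dominates the
  squared value at \<open>o'\<close>, the limit gives \<open>|z| |G|^2 <= |G|\<close>.\<close>

lemma cmod_resolvent_imaginary:
  assumes "Re z = 0"
  shows "cmod G \<le> 1 / cmod z"
proof -
  define S where "S N = (\<Sum>i<N. of_real (A (2 * i)) * (1 / z) ^ Suc (2 * i))" for N
  have z0: "z \<noteq> 0"
    using r z by auto
  have cz: "cnj z = - z"
    using assms by (simp add: complex_eq_iff)
  have lim1: "(\<lambda>N. cmod (z * of_real (E N) - cnj z * of_real (F N))) \<longlonglongrightarrow> cmod (cnj G)"
    by (intro tendsto_intros energy_identity)
  have lim2: "(\<lambda>N. cmod z * (cmod (S N))\<^sup>2) \<longlonglongrightarrow> cmod z * (cmod G)\<^sup>2"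
    using G unfolding S_def sums_def by (intro tendsto_intros)
  have "cmod z * (cmod (S N))\<^sup>2 \<le> cmod (z * of_real (E N) - cnj z * of_real (F N))" for N
  proof -
    have "(cmod (S N))\<^sup>2 \<le> E N"
      using form_ge[where N = N and c = "\<lambda>i. (1 / z) ^ Suc (2 * i)"]
      by (simp add: S_def E_def mult.commute)
    also have "E N \<le> \<bar>E N + F N\<bar>"
      using F_nonneg[of N] by simp
    finally have "cmod z * (cmod (S N))\<^sup>2 \<le> cmod z * \<bar>E N + F N\<bar>"
      by (simp add: mult_left_mono)
    also have "\<dots> = cmod (z * of_real (E N + F N))"
      by (simp add: norm_mult del: of_real_add)
    also have "z * of_real (E N + F N) = z * of_real (E N) - cnj z * of_real (F N)"
      by (simp add: cz algebra_simps)
    finally show ?thesis .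
  qed
  then have "cmod z * (cmod G)\<^sup>2 \<le> cmod (cnj G)"
    by (intro LIMSEQ_le[OF lim2 lim1]) auto
  then have "cmod G * (cmod z * cmod G) \<le> cmod G * 1"
    by (simp add: power2_eq_square mult_ac)
  then show ?thesis
    using z0 by (cases "G = 0") (auto simp: field_simps)
qed

end

end

subsection \<open>The characteristic function\<close>

lemma mem_W_set_iff: "z \<in> W_set k \<longleftrightarrow> \<not> (Re z = 0 \<and> \<bar>Im z\<bar> \<ge> 1 / k)"
proof -
  have "z = \<i> * of_real (Im z)" if "Re z = 0"
    using that by (simp add: complex_eq_iff)
  moreover have "z = - \<i> * of_real (- Im z)" if "Re z = 0"
    using that by (simp add: complex_eq_iff)
  ultimately show ?thesis
    unfolding W_set_def by (auto simp: abs_if split: if_splits)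
qed

lemma open_W_set: "open (W_set k)"
proof -
  have "W_set k = - ({z. Re z = 0} \<inter> {z. \<bar>Im z\<bar> \<ge> 1 / k})"
    by (auto simp: mem_W_set_iff)
  moreover have "closed ({z. Re z = 0} \<inter> {z. \<bar>Im z\<bar> \<ge> 1 / k})"
    by (intro closed_Int closed_Collect_eq closed_Collect_le continuous_intros)
  ultimately show ?thesis
    by (simp add: open_closed)
qed

text \<open>For \<open>w = csqrt (1 + s)\<close> one has \<open>(w - 1) (w + 1) = s\<close>, and
  \<open>Re w >= 0\<close> for the principal root gives \<open>|w + 1| >= 1\<close>.\<close>

lemma norm_csqrt_minus_one_le: "cmod (csqrt (1 + s) - 1) \<le> cmod s"
proof -
  have "1 \<le> Re (csqrt (1 + s) + 1)"
    using Re_csqrt[of "1 + s"] by (simp del: csqrt.simps)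
  also have "\<dots> \<le> cmod (csqrt (1 + s) + 1)"
    by (rule complex_Re_le_cmod)
  finally have "cmod (csqrt (1 + s) - 1) * 1 \<le> cmod (csqrt (1 + s) - 1) * cmod (csqrt (1 + s) + 1)"
    by (intro mult_left_mono) auto
  also have "\<dots> = cmod ((csqrt (1 + s))\<^sup>2 - 1)"
    by (simp add: norm_mult[symmetric] power2_eq_square algebra_simps)
  finally show ?thesis
    by simp
qed

text \<open>\<open>Y\<close> will be the set of neighbours of the root and \<open>q y\<close> the
  product of the transition probabilities along the edge to \<open>y\<close> in both directions.
  Summing over neighbours instead of edge orbits absorbs the multiplicities
  \<open>d_j\<close>.\<close>

locale sqrt_series =
  fixes Y :: "'i set" and q :: "'i \<Rightarrow> real" and k :: real
  assumes q_pos: "\<And>y. y \<in> Y \<Longrightarrow> q y > 0"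
    and q_summable: "q summable_on Y"
    and k_pos: "k > 0"
    and q_le_k: "\<And>y. y \<in> Y \<Longrightarrow> 2 * sqrt (q y) \<le> k"
    and three: "infinite Y \<or> card Y \<ge> 3"
begin

definition cphi :: "complex \<Rightarrow> complex" where
  "cphi t = 1 + (\<Sum>\<^sub>\<infinity>y\<in>Y. (csqrt (1 + 4 * of_real (q y) * t\<^sup>2) - 1) / 2)"

definition phi :: "real \<Rightarrow> real" where
  "phi t = 1 + (\<Sum>\<^sub>\<infinity>y\<in>Y. (sqrt (1 + 4 * q y * t\<^sup>2) - 1) / 2)"

definition phi' :: "real \<Rightarrow> real" where
  "phi' t = (\<Sum>\<^sub>\<infinity>y\<in>Y. 2 * q y * t / sqrt (1 + 4 * q y * t\<^sup>2))"

lemma term_bound: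
  assumes "y \<in> Y"
  shows "cmod ((csqrt (1 + 4 * of_real (q y) * t\<^sup>2) - 1) / 2) \<le> 2 * q y * (cmod t)\<^sup>2"
proof -
  have "cmod (csqrt (1 + 4 * of_real (q y) * t\<^sup>2) - 1) \<le> cmod (4 * of_real (q y) * t\<^sup>2)"
    by (rule norm_csqrt_minus_one_le)
  also have "\<dots> = 4 * q y * (cmod t)\<^sup>2"
    using q_pos[OF assms] by (simp add: norm_mult norm_power)
  finally show ?thesis
    by (simp add: norm_divide)
qed

text \<open>A nonpositive real value forces \<open>z^2\<close> to be real. Real \<open>z\<close>
  give positive values, and an imaginary \<open>z\<close> must satisfy
  \<open>|Im z| >= 1 / (2 sqrt (q y)) >= 1 / k\<close>, which lies on the removed rays.\<close>

lemma branch: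
  assumes z: "z \<in> W_set k" and y: "y \<in> Y"
  shows "1 + 4 * of_real (q y) * z\<^sup>2 \<notin> \<real>\<^sub>\<le>\<^sub>0"
proof
  assume "1 + 4 * of_real (q y) * z\<^sup>2 \<in> \<real>\<^sub>\<le>\<^sub>0"
  then have im: "Im z * Re z = 0" and re: "1 + 4 * q y * ((Re z)\<^sup>2 - (Im z)\<^sup>2) \<le> 0"
    using q_pos[OF y] by (auto simp: complex_nonpos_Reals_iff power2_eq_square algebra_simps)
  have "Re z = 0"
  proof (rule ccontr)
    assume "Re z \<noteq> 0"
    with im have "Im z = 0" by simp
    with re have "1 + 4 * q y * (Re z)\<^sup>2 \<le> 0" by simp
    moreover have "4 * q y * (Re z)\<^sup>2 \<ge> 0"
      using q_pos[OF y] by simp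
    ultimately show False by linarith
  qed
  with re have "1 \<le> 4 * q y * (Im z)\<^sup>2"
    by simp
  also have "\<dots> = (2 * sqrt (q y) * \<bar>Im z\<bar>)\<^sup>2"
    using q_pos[OF y] by (simp add: power_mult_distrib)
  finally have "1 \<le> 2 * sqrt (q y) * \<bar>Im z\<bar>"
    by (rule power2_le_imp_le[of 1, simplified]) (use q_pos[OF y] in auto)
  also have "\<dots> \<le> k * \<bar>Im z\<bar>"
    by (intro mult_right_mono q_le_k y) auto
  finally have "1 / k \<le> \<bar>Im z\<bar>"
    using k_pos by (simp add: field_simps)
  with \<open>Re z = 0\<close> z show False
    by (simp add: mem_W_set_iff)
qed

lemma uniform_limit_cphi:
  "uniform_limit (cball z e) (\<lambda>X t. 1 + (\<Sum>y\<in>X. (csqrt (1 + 4 * of_real (q y) * t\<^sup>2) - 1) / 2)) cphi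
     (finite_subsets_at_top Y)"
proof -
  have "uniform_limit (cball z e) (\<lambda>X t. \<Sum>y\<in>X. (csqrt (1 + 4 * of_real (q y) * t\<^sup>2) - 1) / 2)
     (\<lambda>t. \<Sum>\<^sub>\<infinity>y\<in>Y. (csqrt (1 + 4 * of_real (q y) * t\<^sup>2) - 1) / 2) (finite_subsets_at_top Y)"
  proof (rule Weierstrass_m_test_general)
    fix y t assume y: "y \<in> Y" and t: "t \<in> cball z e"
    have "cmod t \<le> cmod z + e"
      using t norm_triangle_ineq2[of t z] by (simp add: dist_norm norm_minus_commute)
    then have "(cmod t)\<^sup>2 \<le> (cmod z + e)\<^sup>2"
      by (intro power_mono) auto
    then have "2 * q y * (cmod t)\<^sup>2 \<le> 2 * q y * (cmod z + e)\<^sup>2"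
      using q_pos[OF y] by (intro mult_left_mono) auto
    with term_bound[OF y, of t]
    show "norm ((csqrt (1 + 4 * of_real (q y) * t\<^sup>2) - 1) / 2) \<le> 2 * q y * (cmod z + e)\<^sup>2"
      by linarith
  next
    show "(\<lambda>y. 2 * q y * (cmod z + e)\<^sup>2) summable_on Y"
      by (intro summable_on_cmult_left summable_on_cmult_right q_summable)
  qed
  then show ?thesis
    unfolding cphi_def[abs_def] by (intro uniform_limit_intros)
qed

text \<open>Locally uniform convergence along the filter of finite subsets of \<open>Y\<close>
  permits termwise differentiation. Keeping the series for \<open>D\<close> makes the derivative
  computable at real points.\<close>

lemma cphi_derivative:
  assumes z: "z \<in> W_set k"
  obtains D where "(cphi has_field_derivative D) (at z)"
    and "((\<lambda>y. 2 * of_real (q y) * z / csqrt (1 + 4 * of_real (q y) * z\<^sup>2)) has_sum D) Y"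
proof -
  obtain e where e: "e > 0" "cball z e \<subseteq> W_set k"
    using open_W_set z open_contains_cball by blast
  define S where "S = (\<lambda>X t. 1 + (\<Sum>y\<in>X. (csqrt (1 + 4 * of_real (q y) * t\<^sup>2) - 1) / 2))"
  define S' where "S' = (\<lambda>X t. (\<Sum>y\<in>X. 2 * of_real (q y) * t / csqrt (1 + 4 * of_real (q y) * t\<^sup>2)))"
  have deriv: "(S X has_field_derivative S' X w) (at w)" if "X \<subseteq> Y" "w \<in> W_set k" for X w
    unfolding S_def S'_def
    using that branch by (auto intro!: derivative_eq_intros simp: subset_eq mult_ac)
  have ev: "\<forall>\<^sub>F X in finite_subsets_at_top Y. X \<subseteq> Y"
    by (rule eventually_finite_subsets_at_top_weakI) auto
  obtain D where D: "\<And>w. w \<in> ball z e \<Longrightarrow>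
      (cphi has_field_derivative D w) (at w) \<and> ((\<lambda>X. S' X w) \<longlongrightarrow> D w) (finite_subsets_at_top Y)"
  proof (rule has_complex_derivative_uniform_limit)
    show "\<forall>\<^sub>F X in finite_subsets_at_top Y. continuous_on (cball z e) (S X) \<and>
        (\<forall>w\<in>ball z e. (S X has_field_derivative S' X w) (at w))"
      using ev
    proof eventually_elim
      case (elim X)
      then show ?case
        using deriv[OF elim] e ball_subset_cball[of z e]
        by (meson DERIV_isCont continuous_at_imp_continuous_on subsetD)
    qed
    show "uniform_limit (cball z e) S cphi (finite_subsets_at_top Y)"
      unfolding S_def by (rule uniform_limit_cphi)
  qed (use e in auto)
  show ?thesis
    using D[of z] e that[of "D z"] by (simp add: has_sum_def S'_def)
qed

lemma holomorphic_cphi: "cphi holomorphic_on W_set k"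
  unfolding holomorphic_on_open[OF open_W_set]
proof
  fix z assume "z \<in> W_set k"
  then show "\<exists>D. (cphi has_field_derivative D) (at z)"
    by (rule cphi_derivative) blast
qed

section \<open>Restriction of the characteristic function to the real axis\<close>

lemma of_real_mem_W_set: "complex_of_real t \<in> W_set k"
  using k_pos by (simp add: mem_W_set_iff)

lemma csqrt_term:
  assumes "y \<in> Y"
  shows "csqrt (1 + 4 * of_real (q y) * (of_real t)\<^sup>2) = of_real (sqrt (1 + 4 * q y * t\<^sup>2))"
proof -
  have "1 + 4 * q y * t\<^sup>2 \<ge> 0"
    using q_pos[OF assms] by (intro add_nonneg_nonneg) auto
  moreover have "1 + 4 * of_real (q y) * (of_real t)\<^sup>2 = complex_of_real (1 + 4 * q y * t\<^sup>2)"
    by simp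
  ultimately show ?thesis
    by (metis csqrt_of_real)
qed

lemma phi_summable: "((\<lambda>y. (sqrt (1 + 4 * q y * t\<^sup>2) - 1) / 2) has_sum (phi t - 1)) Y"
proof -
  have "norm ((sqrt (1 + 4 * q y * t\<^sup>2) - 1) / 2) \<le> 2 * q y * \<bar>t\<bar>\<^sup>2" if "y \<in> Y" for y
  proof -
    have "(csqrt (1 + 4 * of_real (q y) * (of_real t)\<^sup>2) - 1) / 2
        = complex_of_real ((sqrt (1 + 4 * q y * t\<^sup>2) - 1) / 2)"
      by (simp add: csqrt_term[OF that])
    then show ?thesis
      using term_bound[OF that, of "of_real t"] by (metis norm_of_real real_norm_def)
  qed
  then have "(\<lambda>y. norm ((sqrt (1 + 4 * q y * t\<^sup>2) - 1) / 2)) summable_on Y"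
    by (intro Infinite_Sum.abs_summable_on_comparison_test'[where g = "\<lambda>y. 2 * q y * \<bar>t\<bar>\<^sup>2"]
      summable_on_cmult_left summable_on_cmult_right q_summable) auto
  then have "(\<lambda>y. (sqrt (1 + 4 * q y * t\<^sup>2) - 1) / 2) summable_on Y"
    by (rule abs_summable_summable)
  from has_sum_infsum[OF this] show ?thesis
    by (simp add: phi_def)
qed

lemma cphi_of_real: "cphi (of_real t) = of_real (phi t)"
proof -
  have "((\<lambda>y. complex_of_real ((sqrt (1 + 4 * q y * t\<^sup>2) - 1) / 2)) has_sum of_real (phi t - 1)) Y"
    by (intro has_sum_of_real phi_summable)
  then have "((\<lambda>y. (csqrt (1 + 4 * of_real (q y) * (of_real t)\<^sup>2) - 1) / 2) has_sum of_real (phi t - 1)) Y"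
    by (rule has_sum_cong[THEN iffD1, rotated]) (simp add: csqrt_term)
  then show ?thesis
    by (simp add: cphi_def infsumI)
qed

lemma phi_derivative:
  "(cphi has_field_derivative of_real (phi' t)) (at (of_real t))"
  "((\<lambda>y. 2 * q y * t / sqrt (1 + 4 * q y * t\<^sup>2)) has_sum phi' t) Y"
proof -
  obtain D where D: "(cphi has_field_derivative D) (at (of_real t))"
    and sum: "((\<lambda>y. 2 * of_real (q y) * of_real t / csqrt (1 + 4 * of_real (q y) * (of_real t)\<^sup>2)) has_sum D) Y"
    using cphi_derivative[OF of_real_mem_W_set] by blast
  have "((\<lambda>y. complex_of_real (2 * q y * t / sqrt (1 + 4 * q y * t\<^sup>2))) has_sum D) Y"
    using sum by (rule has_sum_cong[THEN iffD1, rotated]) (simp add: csqrt_term)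
  from has_sum_Re[OF this] has_sum_Im[OF this]
  have re: "((\<lambda>y. 2 * q y * t / sqrt (1 + 4 * q y * t\<^sup>2)) has_sum Re D) Y"
    and im: "((\<lambda>y. 0 :: real) has_sum Im D) Y"
    by (simp_all only: Re_complex_of_real Im_complex_of_real)
  from re show "((\<lambda>y. 2 * q y * t / sqrt (1 + 4 * q y * t\<^sup>2)) has_sum phi' t) Y"
    by (simp add: phi'_def infsumI)
  have "Re D = phi' t"
    using re by (simp add: phi'_def infsumI)
  moreover have "Im D = 0"
    using im by (metis has_sum_0 has_sum_unique)
  ultimately have "D = of_real (phi' t)"
    by (simp add: complex_eq_iff)
  with D show "(cphi has_field_derivative of_real (phi' t)) (at (of_real t))"
    by simp
qed

lemma deriv_cphi: "deriv cphi (of_real t) = of_real (phi' t)"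
  using phi_derivative(1) by (rule DERIV_imp_deriv)

lemma continuous_phi: "continuous_on UNIV phi"
proof -
  have "continuous_on UNIV (\<lambda>t. cphi (of_real t))"
    by (rule continuous_on_compose2[OF holomorphic_on_imp_continuous_on[OF holomorphic_cphi]])
       (auto intro: continuous_intros simp: of_real_mem_W_set)
  then have "continuous_on UNIV (\<lambda>t. Re (cphi (of_real t)))"
    by (rule continuous_on_Re)
  then show ?thesis
    by (simp add: cphi_of_real)
qed

lemma continuous_phi': "continuous_on UNIV phi'"
proof -
  have "continuous_on (W_set k) (deriv cphi)"
    by (intro holomorphic_on_imp_continuous_on holomorphic_deriv holomorphic_cphi open_W_set)
  then have "continuous_on UNIV (\<lambda>t. deriv cphi (of_real t))"
    by (rule continuous_on_compose2) (auto intro: continuous_intros simp: of_real_mem_W_set)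
  then have "continuous_on UNIV (\<lambda>t. Re (deriv cphi (of_real t)))"
    by (rule continuous_on_Re)
  then show ?thesis
    by (simp add: deriv_cphi)
qed

section \<open>The minimiser of \<open>phi t / t\<close>\<close>

lemma phi_ge_1: "phi t \<ge> 1"
proof -
  have "phi t - 1 \<ge> 0"
    by (rule has_sum_nonneg[OF phi_summable]) (use q_pos in \<open>auto simp: less_imp_le\<close>)
  then show ?thesis by simp
qed

text \<open>The derivative of \<open>phi t / t\<close> is \<open>psi t / t^2\<close>.\<close>

definition psi :: "real \<Rightarrow> real" where "psi t = t * phi' t - phi t"

text \<open>With \<open>s\<close> the square root, each summand \<open>f = (s - 1) / 2\<close> of
  \<open>phi\<close> has \<open>t f' - f = (1 - 1 / s) / 2\<close>, which increases for
  \<open>t > 0\<close> from \<open>0\<close> towards \<open>1 / 2\<close>. The \<open>+ 1\<close>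
  compensates the constant term of \<open>phi\<close>.\<close>

lemma psi_has_sum: "((\<lambda>y. (1 - 1 / sqrt (1 + 4 * q y * t\<^sup>2)) / 2) has_sum (psi t + 1)) Y"
proof -
  have "((\<lambda>y. t * (2 * q y * t / sqrt (1 + 4 * q y * t\<^sup>2)) + - ((sqrt (1 + 4 * q y * t\<^sup>2) - 1) / 2))
      has_sum (t * phi' t + - (phi t - 1))) Y"
    by (intro has_sum_add has_sum_cmult_right has_sum_uminusI phi_derivative phi_summable)
  moreover have "t * (2 * q y * t / sqrt (1 + 4 * q y * t\<^sup>2)) + - ((sqrt (1 + 4 * q y * t\<^sup>2) - 1) / 2)
      = (1 - 1 / sqrt (1 + 4 * q y * t\<^sup>2)) / 2" if "y \<in> Y" for y
  proof -
    define s where "s = sqrt (1 + 4 * q y * t\<^sup>2)"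
    have "1 + 4 * q y * t\<^sup>2 > 0"
      using q_pos[OF that] by (intro add_pos_nonneg) auto
    then have "s > 0" and s2: "s\<^sup>2 = 1 + 4 * q y * t\<^sup>2"
      by (auto simp: s_def)
    have "t * (2 * q y * t / s) + - ((s - 1) / 2) = ((s\<^sup>2 - 1) / s - s + 1) / 2"
      unfolding s2 using \<open>s > 0\<close> by (simp add: field_simps power2_eq_square)
    also have "\<dots> = (1 - 1 / s) / 2"
      using \<open>s > 0\<close> by (simp add: field_simps power2_eq_square)
    finally show ?thesis
      by (simp add: s_def)
  qed
  ultimately have "((\<lambda>y. (1 - 1 / sqrt (1 + 4 * q y * t\<^sup>2)) / 2) has_sum (t * phi' t + - (phi t - 1))) Y"
    by (rule has_sum_cong[THEN iffD1, rotated]) 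
  then show ?thesis
    by (simp add: psi_def algebra_simps)
qed

lemma psi_strict_mono:
  assumes "0 < s" "s < t"
  shows "psi s < psi t"
proof -
  have lt: "(1 - 1 / sqrt (1 + 4 * q y * s\<^sup>2)) / 2 < (1 - 1 / sqrt (1 + 4 * q y * t\<^sup>2)) / 2" if "y \<in> Y" for y
  proof -
    have "s\<^sup>2 < t\<^sup>2"
      using assms by (intro power_strict_mono) auto
    then have "1 + 4 * q y * s\<^sup>2 < 1 + 4 * q y * t\<^sup>2"
      using q_pos[OF that] by simp
    moreover have "1 + 4 * q y * s\<^sup>2 > 0"
      using q_pos[OF that] by (intro add_pos_nonneg) auto
    ultimately show ?thesis
      by (simp add: divide_strict_left_mono)
  qed
  obtain y where "y \<in> Y"
    using three by fastforce
  then have "psi s + 1 < psi t + 1"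
    using lt by (intro has_sum_strict_mono[OF psi_has_sum psi_has_sum]) (auto intro: less_imp_le)
  then show ?thesis by simp
qed

text \<open>The summands of \<open>psi t + 1\<close> tend to \<open>1 / 2\<close>, so three of them
  already exceed \<open>1\<close>; this is the use of degree at least three.\<close>

lemma psi_eventually_pos: obtains t where "t > 0" "psi t > 0"
proof -
  obtain T where T: "finite T" "card T = 3" "T \<subseteq> Y"
    using three infinite_arbitrarily_large[of Y 3] obtain_subset_with_card_n[of 3 Y] by metis
  have "T \<noteq> {}"
    using T by auto
  define m where "m = Min (q ` T)"
  have m: "m > 0" "\<And>y. y \<in> T \<Longrightarrow> m \<le> q y"
    using T \<open>T \<noteq> {}\<close> q_pos by (auto simp: m_def)
  \<comment> \<open>This choice gives \<open>1 + 4 m t^2 = 17 >= 4^2\<close>, so each of the three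
    summands is at least \<open>3 / 8\<close>, and \<open>9 / 8 > 1\<close>.\<close>
  define t where "t = sqrt (4 / m)"
  have t: "t > 0" "t\<^sup>2 = 4 / m"
    using m by (auto simp: t_def)
  have ge: "(1 - 1 / sqrt (1 + 4 * q y * t\<^sup>2)) / 2 \<ge> 3 / 8" if "y \<in> T" for y
  proof -
    have "4\<^sup>2 \<le> 1 + 4 * m * t\<^sup>2"
      using m t by simp
    also have "\<dots> \<le> 1 + 4 * q y * t\<^sup>2"
      using m(2)[OF that] by (simp add: mult_right_mono)
    finally have "4 \<le> sqrt (1 + 4 * q y * t\<^sup>2)"
      by (rule real_le_rsqrt)
    then have "1 / sqrt (1 + 4 * q y * t\<^sup>2) \<le> 1 / 4"
      by (intro divide_left_mono mult_pos_pos) linarith+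
    then show ?thesis by simp
  qed
  have "(\<Sum>y\<in>T. 3 / 8 :: real) \<le> (\<Sum>y\<in>T. (1 - 1 / sqrt (1 + 4 * q y * t\<^sup>2)) / 2)"
    using ge by (rule sum_mono)
  also have "\<dots> \<le> psi t + 1"
  proof (rule has_sum_mono2[OF _ psi_has_sum T(3)])
    show "((\<lambda>y. (1 - 1 / sqrt (1 + 4 * q y * t\<^sup>2)) / 2) has_sum
        (\<Sum>y\<in>T. (1 - 1 / sqrt (1 + 4 * q y * t\<^sup>2)) / 2)) T"
      using T by (simp add: has_sum_finite)
    show "(1 - 1 / sqrt (1 + 4 * q y * t\<^sup>2)) / 2 \<ge> 0" if "y \<in> Y - T" for y
    proof -
      have "1 \<le> sqrt (1 + 4 * q y * t\<^sup>2)"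
        using that q_pos[of y] by simp
      then have "1 / sqrt (1 + 4 * q y * t\<^sup>2) \<le> 1 / 1"
        by (intro divide_left_mono mult_pos_pos) linarith+
      then show ?thesis by simp
    qed
  qed
  finally have "psi t > 0"
    using T by simp
  with t that show ?thesis by blast
qed

text \<open>Every summand is convex. After clearing denominators its tangent inequality reads
  \<open>1 + 4 q s t <= a b\<close>, which is Cauchy-Schwarz for \<open>(1, 2 sqrt q s)\<close> and
  \<open>(1, 2 sqrt q t)\<close>.\<close>

lemma phi_tangent: "phi t \<ge> phi s + phi' s * (t - s)"
proof -
  have sum: "((\<lambda>y. (sqrt (1 + 4 * q y * s\<^sup>2) - 1) / 2 + 2 * q y * s / sqrt (1 + 4 * q y * s\<^sup>2) * (t - s))
      has_sum (phi s - 1 + phi' s * (t - s))) Y"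
    by (intro has_sum_add has_sum_cmult_left phi_derivative phi_summable)
  have "phi s - 1 + phi' s * (t - s) \<le> phi t - 1"
  proof (rule has_sum_mono[OF sum phi_summable])
    fix y assume y: "y \<in> Y"
    define a b where "a = sqrt (1 + 4 * q y * s\<^sup>2)" and "b = sqrt (1 + 4 * q y * t\<^sup>2)"
    have pos: "1 + 4 * q y * s\<^sup>2 > 0" "1 + 4 * q y * t\<^sup>2 > 0"
      using q_pos[OF y] by (auto intro!: add_pos_nonneg)
    then have "a > 0" "b > 0" and a2: "a\<^sup>2 = 1 + 4 * q y * s\<^sup>2" and b2: "b\<^sup>2 = 1 + 4 * q y * t\<^sup>2"
      by (auto simp: a_def b_def)
    have "1 + 4 * q y * s * t \<le> a * b"
    proof (rule power2_le_imp_le)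
      have "(a * b)\<^sup>2 - (1 + 4 * q y * s * t)\<^sup>2 = 4 * q y * (s - t)\<^sup>2"
        unfolding power_mult_distrib a2 b2 by (simp add: power2_eq_square algebra_simps)
      moreover have "\<dots> \<ge> 0"
        using q_pos[OF y] by simp
      ultimately show "(1 + 4 * q y * s * t)\<^sup>2 \<le> (a * b)\<^sup>2"
        by linarith
    qed (use \<open>a > 0\<close> \<open>b > 0\<close> in auto)
    moreover have "a * ((a - 1) / 2 + 2 * q y * s / a * (t - s)) = (a\<^sup>2 - a + 4 * q y * s * t - 4 * q y * s\<^sup>2) / 2"
      using \<open>a > 0\<close> by (simp add: field_simps power2_eq_square)
    ultimately have "a * ((a - 1) / 2 + 2 * q y * s / a * (t - s)) \<le> a * ((b - 1) / 2)"
      unfolding a2 by (simp add: algebra_simps)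
    then show "(a - 1) / 2 + 2 * q y * s / a * (t - s) \<le> (b - 1) / 2"
      using \<open>a > 0\<close> by simp
  qed
  then show ?thesis by simp
qed

text \<open>\<open>psi\<close> changes sign, and it is strictly increasing, so it has exactly one
  positive zero \<theta>. The tangent of \<open>phi\<close> at \<theta> passes through the origin,
  hence convexity makes its slope the minimum of \<open>phi t / t\<close>.\<close>

lemma theta_exists:
  obtains \<theta> where "\<theta> > 0" "phi' \<theta> = phi \<theta> / \<theta>"
    and "\<And>t. t > 0 \<Longrightarrow> phi' t = phi t / t \<Longrightarrow> t = \<theta>"
    and "\<And>t. t > 0 \<Longrightarrow> phi \<theta> / \<theta> \<le> phi t / t"
proof -
  have psi_iff: "phi' t = phi t / t \<longleftrightarrow> psi t = 0" if "t > 0" for t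
    using that by (auto simp: psi_def field_simps)
  obtain T where T: "T > 0" "psi T > 0"
    using psi_eventually_pos by blast
  have "psi 0 \<le> 0"
    using phi_ge_1[of 0] by (simp add: psi_def)
  have "continuous_on {0..T} psi"
    unfolding psi_def
    by (intro continuous_intros continuous_on_subset[OF continuous_phi] continuous_on_subset[OF continuous_phi']) auto
  then obtain \<theta> where \<theta>: "0 \<le> \<theta>" "\<theta> \<le> T" "psi \<theta> = 0"
    using IVT'[of psi 0 0 T] T \<open>psi 0 \<le> 0\<close> by auto
  have "\<theta> \<noteq> 0"
    using \<theta> phi_ge_1[of 0] by (auto simp: psi_def)
  with \<theta> have pos: "\<theta> > 0" by simp
  have eq: "phi \<theta> = \<theta> * phi' \<theta>"
    using \<theta> by (simp add: psi_def)
  show ?thesis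
  proof (rule that[OF pos])
    show "phi' \<theta> = phi \<theta> / \<theta>"
      using psi_iff[OF pos] \<theta> by simp
    show "t = \<theta>" if "t > 0" "phi' t = phi t / t" for t
      using psi_strict_mono[of t \<theta>] psi_strict_mono[of \<theta> t] psi_iff[of t] that pos \<theta>
      by (cases t \<theta> rule: linorder_cases) auto
    show "phi \<theta> / \<theta> \<le> phi t / t" if "t > 0" for t
      using phi_tangent[of \<theta> t] that pos eq by (simp add: field_simps)
  qed
qed

end

subsection \<open>Resolvent of a moment sequence\<close>

locale resolvent_series = moments A v w o' + sqrt_series Y q k
  for A :: "nat \<Rightarrow> real" and v :: "nat \<Rightarrow> 'v \<Rightarrow> real" and w o'
    and Y :: "'i set" and q :: "'i \<Rightarrow> real" and k +
  assumes A_nonneg: "\<And>n. A n \<ge> 0" and A_le_1: "\<And>n. A n \<le> 1" and A_odd: "\<And>n. odd n \<Longrightarrow> A n = 0"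
begin

section \<open>Growth of the coefficients and the resolvent outside the disc of radius
  \<open>rho\<close>\<close>

definition rho :: real where
  "rho = real_of_ereal (limsup (\<lambda>n. ereal (A n powr (1 / real n))))"

definition G :: "complex \<Rightarrow> complex" where
  "G z = (\<Sum>n. complex_of_real (A n) / z ^ Suc n)"

text \<open>The limsup lies between \<open>0\<close> and \<open>1\<close>, so
  \<open>real_of_ereal\<close> does not fall back to its default value at infinity.\<close>

lemma limsup_eq: "limsup (\<lambda>n. ereal (A n powr (1 / real n))) = ereal rho"
  and rho_nonneg: "rho \<ge> 0"
proof -
  let ?L = "limsup (\<lambda>n. ereal (A n powr (1 / real n)))"
  have "ereal (A n powr (1 / real n)) \<le> 1" for n
    using powr_mono2[of "1 / real n" "A n" 1] A_nonneg[of n] A_le_1[of n] by simp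
  then have "?L \<le> 1"
    by (intro Limsup_bounded always_eventually) auto
  moreover have "0 \<le> ?L"
    by (intro le_Limsup always_eventually) auto
  ultimately show "?L = ereal rho" "rho \<ge> 0"
    unfolding rho_def by (cases ?L; simp)+
qed

lemma growth:
  assumes "r > rho"
  obtains C where "\<And>n. \<bar>A n\<bar> \<le> C * r ^ n"
proof -
  have r: "r > 0"
    using assms rho_nonneg by simp
  have "limsup (\<lambda>n. ereal (A n powr (1 / real n))) < ereal r"
    using assms by (simp add: limsup_eq)
  from Limsup_lessD[OF this] obtain n0 where n0: "\<And>n. n \<ge> n0 \<Longrightarrow> A n powr (1 / real n) < r"
    by (auto simp: eventually_sequentially)
  have large: "A n \<le> r ^ n" if "n \<ge> n0" "n > 0" for n
  proof (cases "A n = 0")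
    case False
    then have pos: "A n > 0"
      using A_nonneg[of n] by simp
    have "A n = (A n powr (1 / real n)) ^ n"
      using pos \<open>n > 0\<close> by (simp add: powr_powr powr_realpow[symmetric])
    also have "\<dots> \<le> r ^ n"
      using n0[OF that(1)] by (intro power_mono) auto
    finally show ?thesis .
  qed (use r in simp)
  \<comment> \<open>The sum absorbs the finitely many \<open>n <= n0\<close>, for which only
    \<open>A n <= 1\<close> is available.\<close>
  define C where "C = 1 + (\<Sum>n\<le>n0. 1 / r ^ n)"
  have "C \<ge> 1"
    using r by (simp add: C_def sum_nonneg)
  have "\<bar>A n\<bar> \<le> C * r ^ n" for n
  proof (cases "n \<le> n0")
    case True
    have "1 / r ^ n \<le> (\<Sum>n\<le>n0. 1 / r ^ n)"
      using True r by (intro member_le_sum) auto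
    then have "1 / r ^ n * r ^ n \<le> C * r ^ n"
      using r by (intro mult_right_mono) (auto simp: C_def)
    then show ?thesis
      using A_nonneg[of n] A_le_1[of n] r by simp
  next
    case False
    then have "A n \<le> r ^ n"
      by (intro large) auto
    also have "\<dots> \<le> C * r ^ n"
      using \<open>C \<ge> 1\<close> r by simp
    finally show ?thesis
      using A_nonneg[of n] by simp
  qed
  then show ?thesis
    by (rule that)
qed

lemma rho_le:
  assumes "l > 0" and "\<And>n. A n \<le> l ^ n"
  shows "rho \<le> l"
proof -
  have "A n powr (1 / real n) \<le> l" if "n > 0" for n
  proof -
    have "A n powr (1 / real n) \<le> (l ^ n) powr (1 / real n)"
      using assms A_nonneg[of n] by (intro powr_mono2) auto
    also have "\<dots> = l"
      using \<open>l > 0\<close> that by (simp add: powr_realpow[symmetric] powr_powr)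
    finally show ?thesis .
  qed
  then have "limsup (\<lambda>n. ereal (A n powr (1 / real n))) \<le> ereal l"
    by (intro Limsup_bounded) (auto simp: eventually_sequentially intro!: exI[of _ 1])
  then show ?thesis
    by (simp add: limsup_eq)
qed

lemma summable_powers:
  assumes "r > rho"
  shows "summable (\<lambda>n. complex_of_real (A n) * (of_real (1 / r)) ^ n)"
proof -
  obtain s where s: "rho < s" "s < r"
    using assms dense by blast
  then obtain C where C: "\<And>n. \<bar>A n\<bar> \<le> C * s ^ n"
    using growth by blast
  have pos: "s > 0" "r > 0"
    using s rho_nonneg by auto
  show ?thesis
  proof (rule summable_comparison_test')
    show "summable (\<lambda>n. C * (s / r) ^ n)"
      using s pos by (intro summable_mult summable_geometric) auto
    show "norm (complex_of_real (A n) * (of_real (1 / r)) ^ n) \<le> C * (s / r) ^ n" for n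
      using C[of n] pos by (simp add: norm_mult norm_power norm_divide power_divide divide_right_mono)
  qed
qed

text \<open>\<open>G z\<close> is \<open>1 / z\<close> times a power series in \<open>1 / z\<close>;
  a radius strictly between \<open>rho\<close> and \<open>|z|\<close> leaves room for convergence
  near \<open>z\<close>.\<close>

lemma G_power_series:
  assumes z: "cmod z > rho"
  shows "(\<lambda>n. of_real (A n) * (1 / z) ^ n) sums (z * G z)"
    and "G field_differentiable (at z)"
proof -
  obtain r where r: "rho < r" "r < cmod z"
    using z dense by blast
  have pos: "r > 0"
    using r rho_nonneg by simp
  let ?f = "\<lambda>u. \<Sum>n. complex_of_real (A n) * u ^ n"
  have small: "cmod (1 / u) < cmod (complex_of_real (1 / r))" if "cmod u > r" for u
    using that pos by (simp add: norm_divide frac_less2)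
  have sum: "summable (\<lambda>n. complex_of_real (A n) * (1 / u) ^ n)" if "cmod u > r" for u
    by (rule powser_inside[OF summable_powers[OF r(1)] small[OF that]])
  have G: "G u = 1 / u * ?f (1 / u)" if "cmod u > r" for u
    unfolding G_def using suminf_mult[OF sum[OF that], of "1 / u"]
    by (simp add: power_divide field_simps)
  show "(\<lambda>n. of_real (A n) * (1 / z) ^ n) sums (z * G z)"
    using summable_sums[OF sum[OF r(2)]] G[OF r(2)] r pos by auto
  have "((\<lambda>u. 1 / u * ?f (1 / u)) has_field_derivative
      (- 1 / z\<^sup>2) * ?f (1 / z) + ((\<Sum>n. diffs (\<lambda>n. complex_of_real (A n)) n * (1 / z) ^ n) * (- 1 / z\<^sup>2)) * (1 / z)) (at z)"
  proof (rule DERIV_mult)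
    show inv: "((\<lambda>u. 1 / u) has_field_derivative - 1 / z\<^sup>2) (at z)"
      using r pos by (auto intro!: derivative_eq_intros simp: power2_eq_square)
    show "((\<lambda>u. ?f (1 / u)) has_field_derivative
        (\<Sum>n. diffs (\<lambda>n. complex_of_real (A n)) n * (1 / z) ^ n) * (- 1 / z\<^sup>2)) (at z)"
      by (rule DERIV_chain2[OF termdiffs_strong[OF summable_powers[OF r(1)] small[OF r(2)]] inv])
  qed
  moreover have "open {u. cmod u > r}"
    by (intro open_Collect_less continuous_intros)
  ultimately have "(G has_field_derivative
      (- 1 / z\<^sup>2) * ?f (1 / z) + ((\<Sum>n. diffs (\<lambda>n. complex_of_real (A n)) n * (1 / z) ^ n) * (- 1 / z\<^sup>2)) * (1 / z)) (at z)"
    by (rule has_field_derivative_transform_within_open) (use r G in auto)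
  then show "G field_differentiable (at z)"
    unfolding field_differentiable_def by blast
qed

lemma G_uminus: "G (- z) = - G z" if "cmod z > rho"
proof -
  have "(\<lambda>n. complex_of_real (A n) * (1 / - z) ^ n) = (\<lambda>n. of_real (A n) * (1 / z) ^ n)"
  proof
    fix n
    show "complex_of_real (A n) * (1 / - z) ^ n = of_real (A n) * (1 / z) ^ n"
      using A_odd[of n] by (cases "even n") (auto simp: power_divide)
  qed
  then have "- z * G (- z) = z * G z"
    using G_power_series(1)[OF that] G_power_series(1)[of "- z"] that sums_unique2 by fastforce
  moreover have "z \<noteq> 0"
    using that rho_nonneg by auto
  ultimately show ?thesis
    by (metis minus_equation_iff minus_mult_left mult_cancel_left minus_mult_right)
qed

text \<open>This is the form of the series that the energy identity expects. The odd coefficients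
  vanish, so it is a subsequence of the partial sums of \<open>G\<close>.\<close>

lemma G_even_series:
  assumes z: "cmod z > rho"
  shows "(\<lambda>i. of_real (A (2 * i)) * (1 / z) ^ Suc (2 * i)) sums G z"
proof -
  have z0: "z \<noteq> 0"
    using z rho_nonneg by auto
  have "(\<lambda>n. 1 / z * (of_real (A n) * (1 / z) ^ n)) sums (1 / z * (z * G z))"
    by (intro sums_mult G_power_series z)
  then have full: "(\<lambda>n. of_real (A n) * (1 / z) ^ Suc n) sums G z"
    using z0 by (simp add: mult_ac)
  have "(\<Sum>n<2 * N. of_real (A n) * (1 / z) ^ Suc n) = (\<Sum>i<N. of_real (A (2 * i)) * (1 / z) ^ Suc (2 * i))" for N
    by (induction N) (auto simp: A_odd)
  moreover have "(\<lambda>N. \<Sum>n<2 * N. of_real (A n) * (1 / z) ^ Suc n) \<longlonglongrightarrow> G z"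
    using full unfolding sums_def
    by (rule LIMSEQ_subseq_LIMSEQ[where f = "\<lambda>N. 2 * N", unfolded comp_def]) (simp add: strict_mono_def)
  ultimately show ?thesis
    by (simp add: sums_def)
qed

lemma G_Re_nonneg:
  assumes z: "cmod z > rho" and "Re z \<ge> 0"
  shows "Re (G z) \<ge> 0"
proof -
  obtain r where r: "rho < r" "r < cmod z"
    using z dense by blast
  obtain C where C: "\<And>n. \<bar>A n\<bar> \<le> C * r ^ n"
    using growth[OF r(1)] by blast
  show ?thesis
    using Re_resolvent_nonneg[OF C _ r(2) G_even_series[OF z]] assms r rho_nonneg by simp
qed

lemma cmod_G_le:
  assumes z: "cmod z > rho" and "Re z = 0"
  shows "cmod (G z) \<le> 1 / cmod z"
proof -
  obtain r where r: "rho < r" "r < cmod z"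
    using z dense by blast
  obtain C where C: "\<And>n. \<bar>A n\<bar> \<le> C * r ^ n"
    using growth[OF r(1)] by blast
  show ?thesis
    using cmod_resolvent_imaginary[OF C _ r(2) G_even_series[OF z]] assms r rho_nonneg by simp
qed

lemma G_of_real:
  assumes "l > rho"
  shows "Im (G (of_real l)) = 0"
proof -
  have l: "cmod (of_real l) > rho"
    using assms rho_nonneg by simp
  have "(\<lambda>n. Im (of_real (A n) * (1 / of_real l) ^ n)) sums Im (of_real l * G (of_real l))"
    by (rule sums_Im[OF G_power_series(1)[OF l]])
  moreover have "Im (of_real (A n) * (1 / of_real l) ^ n) = 0" for n
  proof -
    have "of_real (A n) * (1 / of_real l) ^ n = complex_of_real (A n * (1 / l) ^ n)"
      by simp
    then show ?thesis
      by (metis Im_complex_of_real)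
  qed
  ultimately have "Im (of_real l * G (of_real l)) = 0"
    using sums_0 sums_unique2 by fastforce
  then show ?thesis
    using assms rho_nonneg by simp
qed

section \<open>The right half of the domain\<close>

definition D :: "complex set" where "D = {z. Re z > 0 \<and> cmod z > rho}"

lemma of_real_mem_D: "rho < l \<Longrightarrow> complex_of_real l \<in> D"
  using rho_nonneg by (simp add: D_def)

lemma open_D: "open D"
  unfolding D_def by (intro open_Collect_conj open_Collect_less continuous_intros)

text \<open>Polar coordinates present the domain as the continuous image of a product of two
  intervals.\<close>

lemma connected_D: "connected D"
proof -
  let ?f = "\<lambda>(s, t). complex_of_real s * cis t"
  have "D = ?f ` ({rho<..} \<times> {- (pi / 2)<..<pi / 2})"
  proof (intro equalityI subsetI)
    fix z assume z: "z \<in> D"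
    then have "z \<noteq> 0" "Re z > 0"
      by (auto simp: D_def)
    then have "\<bar>Arg z\<bar> < pi / 2"
      using Arg_Re_pos[of z] by simp
    then have "(cmod z, Arg z) \<in> {rho<..} \<times> {- (pi / 2)<..<pi / 2}"
      using z by (auto simp: D_def)
    moreover have "z = ?f (cmod z, Arg z)"
      using \<open>z \<noteq> 0\<close> by (simp add: rcis_cmod_Arg[unfolded rcis_def])
    ultimately show "z \<in> ?f ` ({rho<..} \<times> {- (pi / 2)<..<pi / 2})"
      by (rule rev_image_eqI)
  next
    fix z assume "z \<in> ?f ` ({rho<..} \<times> {- (pi / 2)<..<pi / 2})"
    then obtain s t where st: "s > rho" "- (pi / 2) < t" "t < pi / 2" "z = of_real s * cis t"
      by auto
    then have "cos t > 0" "s > 0"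
      using cos_gt_zero_pi rho_nonneg by auto
    with st show "z \<in> D"
      by (simp add: D_def norm_mult)
  qed
  moreover have "connected (?f ` ({rho<..} \<times> {- (pi / 2)<..<pi / 2}))"
    by (intro connected_continuous_image connected_Times)
       (auto simp: case_prod_unfold intro!: continuous_intros)
  ultimately show ?thesis
    by simp
qed

lemma holomorphic_G: "G holomorphic_on D"
  by (auto simp: holomorphic_on_def D_def intro!: field_differentiable_at_within G_power_series)

end

text \<open>The two hypotheses isolate what the explicit superharmonic function on the tree
  contributes; the rest of the argument is complex analysis of \<open>G\<close>.\<close>

locale solvable_resolvent = resolvent_series +
  assumes rho_le_phi: "\<And>t. t > 0 \<Longrightarrow> rho \<le> phi t / t"
    and G_phi: "\<And>t. 0 < t \<Longrightarrow> t < 1 \<Longrightarrow> G (of_real (phi t / t)) = of_real t"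
begin

lemma phi_over_t_mem_D:
  assumes "0 < t" "t < 1"
  shows "complex_of_real (phi t / t) \<in> D"
proof -
  have "1 < 1 / t"
    using assms by simp
  also have "1 / t \<le> phi t / t"
    using assms phi_ge_1 by (intro divide_right_mono) auto
  finally have "phi t / t > 1" .
  moreover have "rho \<le> 1"
    by (rule rho_le) (use A_le_1 in auto)
  ultimately show ?thesis
    by (intro of_real_mem_D) simp
qed

text \<open>\<open>G\<close> is not constant, as it takes the values \<open>1 / 2\<close> and
  \<open>1 / 3\<close>, so it is an open map. If \<open>Re (G z)\<close> were \<open>0\<close>,
  points just to the left of \<open>G z\<close> would also be values, against
  \<open>G_Re_nonneg\<close>.\<close>

lemma G_Re_pos:
  assumes z: "z \<in> D"
  shows "Re (G z) > 0"
proof -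
  have "\<not> G constant_on D"
  proof
    assume "G constant_on D"
    then have "G (of_real (phi (1/2) / (1/2))) = G (of_real (phi (1/3) / (1/3)))"
      using phi_over_t_mem_D[of "1/2"] phi_over_t_mem_D[of "1/3"] unfolding constant_on_def by auto
    then show False
      using G_phi[of "1/2"] G_phi[of "1/3"] by (simp add: complex_eq_iff)
  qed
  then have "open (G ` D)"
    using open_mapping_thm[OF holomorphic_G open_D connected_D open_D] by auto
  then obtain e where e: "e > 0" "ball (G z) e \<subseteq> G ` D"
    using z open_contains_ball by blast
  have "G z - of_real (e / 2) \<in> ball (G z) e"
    using e by (simp add: dist_norm)
  then obtain u where "u \<in> D" "G u = G z - of_real (e / 2)"
    using e by (metis imageE subsetD)
  then show ?thesis
    using G_Re_nonneg[of u] e by (simp add: D_def)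
qed

lemma G_mem_W: "z \<in> D \<Longrightarrow> G z \<in> W_set k"
  using G_Re_pos[of z] by (simp add: mem_W_set_iff)

lemma functional_equation_D:
  assumes z: "z \<in> D"
  shows "z * G z = cphi (G z)"
proof -
  define \<xi> where "\<xi> = complex_of_real (phi (1/2) / (1/2))"
  define U where "U = (\<lambda>t. complex_of_real (phi t / t)) ` {0<..<1}"
  \<comment> \<open>The shift by \<open>3\<close> keeps \<open>t n\<close> below \<open>1\<close>,
    as \<open>G_phi\<close> requires.\<close>
  define t :: "nat \<Rightarrow> real" where "t n = 1 / 2 + 1 / real (n + 3)" for n
  have t: "0 < t n" "t n < 1" "t n \<noteq> 1 / 2" for n
    by (auto simp: t_def field_simps)
  have "(\<lambda>n. 1 / real (n + 3)) \<longlonglongrightarrow> 0"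
    using LIMSEQ_ignore_initial_segment[OF lim_1_over_n, of 3] by simp
  then have "t \<longlonglongrightarrow> 1 / 2 + 0"
    unfolding t_def by (intro tendsto_intros)
  then have tlim: "t \<longlonglongrightarrow> 1 / 2"
    by simp
  have "(\<lambda>n. phi (t n)) \<longlonglongrightarrow> phi (1 / 2)"
    using continuous_on_tendsto_compose[OF continuous_phi tlim] by simp
  then have lim: "(\<lambda>n. complex_of_real (phi (t n) / t n)) \<longlonglongrightarrow> \<xi>"
    unfolding \<xi>_def by (intro tendsto_intros tlim) auto
  have "complex_of_real (phi (t n) / t n) \<in> U - {\<xi>}" for n
  proof -
    have "complex_of_real (phi (t n) / t n) \<in> U"
      using t[of n] by (auto simp: U_def)
    \<comment> \<open>On the interval \<open>G\<close> is a left inverse of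
      \<open>phi t / t\<close>, so distinct parameters give distinct points.\<close>
    moreover have "complex_of_real (phi (t n) / t n) \<noteq> \<xi>"
    proof
      assume "complex_of_real (phi (t n) / t n) = \<xi>"
      then have "complex_of_real (t n) = of_real (1 / 2)"
        using G_phi[of "t n"] G_phi[of "1 / 2"] t[of n] unfolding \<xi>_def by auto
      then show False
        using t(3)[of n] by (metis of_real_eq_iff)
    qed
    ultimately show ?thesis by simp
  qed
  with lim have islimpt: "\<xi> islimpt U"
    unfolding islimpt_sequential by (intro exI[of _ "\<lambda>n. complex_of_real (phi (t n) / t n)"]) auto
  have holo: "(\<lambda>z. z * G z - cphi (G z)) holomorphic_on D"
    using holomorphic_on_compose_gen[OF holomorphic_G holomorphic_cphi] G_mem_W
    by (intro holomorphic_intros holomorphic_G) (auto simp: comp_def)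
  have "z * G z - cphi (G z) = 0"
  proof (rule analytic_continuation[OF holo open_D connected_D _ _ islimpt _ z])
    show "U \<subseteq> D"
      using phi_over_t_mem_D by (auto simp: U_def)
    show "\<xi> \<in> D"
      unfolding \<xi>_def by (rule phi_over_t_mem_D) auto
    show "u * G u - cphi (G u) = 0" if u: "u \<in> U" for u
    proof -
      obtain s where s: "0 < s" "s < 1" "u = complex_of_real (phi s / s)"
        using u by (auto simp: U_def)
      then show ?thesis
        using G_phi[OF s(1,2)] by (simp add: cphi_of_real)
    qed
  qed
  then show ?thesis by simp
qed

lemma functional_equation:
  assumes z: "z \<in> U_set rho k"
  shows "z * G z = cphi (G z)"
proof -
  have zr: "cmod z > rho"
    using z by (simp add: U_set_def)
  consider "Re z > 0" | "Re z < 0" | "Re z = 0"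
    by linarith
  then show ?thesis
  proof cases
    case 1
    then show ?thesis
      using zr by (intro functional_equation_D) (simp add: D_def)
  next
    case 2
    \<comment> \<open>Both \<open>z * G z\<close> and \<open>cphi (G z)\<close> are unchanged under
      \<open>z\<close> to \<open>- z\<close>, because \<open>G\<close> is odd and
      \<open>cphi\<close> even.\<close>
    then have "- z * G (- z) = cphi (G (- z))"
      using zr by (intro functional_equation_D) (simp add: D_def)
    then show ?thesis
      by (simp add: G_uminus[OF zr] cphi_def)
  next
    case 3
    have zi: "z = \<i> * of_real (Im z)" "z = - \<i> * of_real (- Im z)"
      using 3 by (auto simp: complex_eq_iff)
    have cm: "cmod z = \<bar>Im z\<bar>"
      using 3 by (simp add: cmod_def)
    \<comment> \<open>On the imaginary axis the slits removed in \<open>U_set\<close> leave only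
      \<open>|z| > k\<close>. The bound \<open>1 / |z|\<close> then places \<open>G z\<close>
      strictly below the branch points.\<close>
    have "k < cmod z"
    proof (rule ccontr)
      assume "\<not> k < cmod z"
      then show False
        using z zr zi cm unfolding U_set_def by (cases "Im z \<ge> 0") auto
    qed
    have "cmod (G z) \<le> 1 / cmod z"
      by (rule cmod_G_le[OF zr 3])
    also have "\<dots> < 1 / k"
      using \<open>k < cmod z\<close> k_pos by (intro divide_strict_left_mono mult_pos_pos) linarith+
    finally have "\<bar>Im (G z)\<bar> < 1 / k"
      using abs_Im_le_cmod[of "G z"] by linarith
    then have Gz: "G z \<in> W_set k"
      by (simp add: mem_W_set_iff)
    \<comment> \<open>Approaching \<open>z\<close> horizontally from the right keeps the modulus at
      least \<open>|z|\<close>, so the sequence stays in \<open>D\<close>.\<close>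
    define u where "u n = z + of_real (1 / real (Suc n))" for n
    have "(\<lambda>n. 1 / real (Suc n)) \<longlonglongrightarrow> 0"
      using LIMSEQ_ignore_initial_segment[OF lim_1_over_n, of 1] by simp
    then have "u \<longlonglongrightarrow> z + of_real 0"
      unfolding u_def by (intro tendsto_intros)
    then have u: "u \<longlonglongrightarrow> z"
      by simp
    have uD: "u n \<in> D" for n
    proof -
      have "cmod z \<le> cmod (u n)"
        unfolding cm using abs_Im_le_cmod[of "u n"] by (simp add: u_def)
      moreover have "Re (u n) > 0"
        using 3 by (simp add: u_def)
      ultimately show ?thesis
        using zr by (simp add: D_def)
    qed
    have "isCont G z"
      using G_power_series(2)[OF zr] by (rule field_differentiable_imp_continuous_at)
    then have Gu: "(\<lambda>n. G (u n)) \<longlonglongrightarrow> G z"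
      using u by (rule isCont_tendsto_compose)
    have "isCont cphi (G z)"
      using holomorphic_on_imp_continuous_on[OF holomorphic_cphi] Gz open_W_set
      by (simp add: continuous_on_eq_continuous_at)
    then have "(\<lambda>n. cphi (G (u n))) \<longlonglongrightarrow> cphi (G z)"
      using Gu by (rule isCont_tendsto_compose)
    moreover have "(\<lambda>n. u n * G (u n)) \<longlonglongrightarrow> z * G z"
      by (intro tendsto_intros u Gu)
    ultimately show ?thesis
      using functional_equation_D[OF uD] LIMSEQ_unique by (metis (no_types, lifting) ext)
  qed
qed

text \<open>Each \<open>l > rho\<close> is itself of the form \<open>phi g / g\<close>, with
  \<open>g\<close> the positive value of \<open>G\<close> at \<open>l\<close>; then \<open>l\<close>
  decreases to \<open>rho\<close>.\<close>

lemma rho_ge: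
  assumes min: "\<And>t. t > 0 \<Longrightarrow> m \<le> phi t / t"
  shows "m \<le> rho"
proof (rule dense_ge)
  fix l assume l: "rho < l"
  then have lD: "complex_of_real l \<in> D"
    by (rule of_real_mem_D)
  define g where "g = Re (G (of_real l))"
  have "g > 0"
    using G_Re_pos[OF lD] by (simp add: g_def)
  have "G (of_real l) = of_real g"
    using G_of_real[OF l] by (simp add: g_def complex_eq_iff)
  then have "complex_of_real (l * g) = of_real (phi g)"
    using functional_equation_D[OF lD] by (simp add: cphi_of_real)
  then have "l * g = phi g"
    by (simp only: of_real_eq_iff)
  then show "m \<le> l"
    using min[OF \<open>g > 0\<close>] \<open>g > 0\<close> by (metis nonzero_mult_div_cancel_right less_numeral_extra(3))
qed

end

subsection \<open>Invariant walks on trees\<close>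

locale tree_walk =
  fixes adj :: "'v \<Rightarrow> 'v \<Rightarrow> bool" and \<Gamma> :: "('v \<Rightarrow> 'v) set"
    and p :: "'v \<Rightarrow> 'v \<Rightarrow> real" and r :: 'v
  assumes tree: "is_tree adj" and degree: "min_degree3 adj"
    and group: "aut_subgroup adj \<Gamma>" and transitive: "vertex_transitive \<Gamma>"
    and walk: "nn_stochastic adj p" and invar: "invariant \<Gamma> p"
begin

sublocale markov_kernel p
  using walk by unfold_locales (auto simp: nn_stochastic_def)

lemma p_pos_iff: "p x y > 0 \<longleftrightarrow> adj x y"
  using walk by (auto simp: nn_stochastic_def)

lemma adj_sym: "adj x y \<longleftrightarrow> adj y x"
  using tree by (auto simp: is_tree_def)

lemma p_eq_0: "\<not> adj x y \<Longrightarrow> p x y = 0"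
  using p_pos_iff[of x y] p_nonneg[of x y] by linarith

lemma p_invariant: "g \<in> \<Gamma> \<Longrightarrow> p (g x) (g y) = p x y"
  using invar by (auto simp: invariant_def)

lemma adj_translate: "g \<in> \<Gamma> \<Longrightarrow> adj (g x) (g y) \<longleftrightarrow> adj x y"
  using group by (auto simp: aut_subgroup_def is_aut_def)

section \<open>Edge orbits and sums over the neighbours of the root\<close>

lemma mem_edge_orbit: "(x, y) \<in> edge_orbit \<Gamma> x y"
proof -
  have "id \<in> \<Gamma>"
    using group by (simp add: aut_subgroup_def)
  then show ?thesis
    unfolding edge_orbit_def by (intro CollectI exI[of _ id]) simp
qed

text \<open>Invariance makes \<open>p\<close> constant on the orbit, so the choice inside
  \<open>orbit_p\<close> is immaterial.\<close>

lemma orbit_p_edge_orbit: "orbit_p p (edge_orbit \<Gamma> x y) = p x y"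
proof -
  have "(SOME e. e \<in> edge_orbit \<Gamma> x y) \<in> edge_orbit \<Gamma> x y"
    using mem_edge_orbit by (rule someI)
  then show ?thesis
    by (auto simp: orbit_p_def Let_def edge_orbit_def p_invariant)
qed

lemma orbit_rev_edge_orbit: "orbit_rev (edge_orbit \<Gamma> x y) = edge_orbit \<Gamma> y x"
  by (auto simp: orbit_rev_def edge_orbit_def image_def)

lemma edge_orbit_translate:
  assumes g: "g \<in> \<Gamma>"
  shows "edge_orbit \<Gamma> (g x) (g y) = edge_orbit \<Gamma> x y"
proof (intro equalityI subsetI)
  fix e assume "e \<in> edge_orbit \<Gamma> (g x) (g y)"
  then obtain h where h: "h \<in> \<Gamma>" "e = (h (g x), h (g y))"
    by (auto simp: edge_orbit_def)
  have "h \<circ> g \<in> \<Gamma>"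
    using group g h by (auto simp: aut_subgroup_def)
  moreover have "e = ((h \<circ> g) x, (h \<circ> g) y)"
    using h by simp
  ultimately show "e \<in> edge_orbit \<Gamma> x y"
    unfolding edge_orbit_def by blast
next
  fix e assume "e \<in> edge_orbit \<Gamma> x y"
  then obtain h where h: "h \<in> \<Gamma>" "e = (h x, h y)"
    by (auto simp: edge_orbit_def)
  have "h \<circ> inv g \<in> \<Gamma>" "bij g"
    using group g h by (auto simp: aut_subgroup_def is_aut_def)
  moreover from this have "e = ((h \<circ> inv g) (g x), (h \<circ> inv g) (g y))"
    using h by (simp add: bij_is_inj)
  ultimately show "e \<in> edge_orbit \<Gamma> (g x) (g y)"
    unfolding edge_orbit_def by blast
qed

text \<open>By vertex transitivity every oriented edge can be moved so that it starts at
  \<open>r\<close>.\<close>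

lemma edge_orbits_eq: "edge_orbits adj \<Gamma> = edge_orbit \<Gamma> r ` nbrs adj r"
proof (intro equalityI subsetI)
  fix j assume "j \<in> edge_orbits adj \<Gamma>"
  then obtain x y where xy: "adj x y" "j = edge_orbit \<Gamma> x y"
    by (auto simp: edge_orbits_def)
  obtain g where g: "g \<in> \<Gamma>" "g x = r"
    using transitive by (auto simp: vertex_transitive_def)
  have "adj (g x) (g y)"
    using g(1) xy(1) by (simp only: adj_translate)
  moreover have "j = edge_orbit \<Gamma> r (g y)"
    using edge_orbit_translate[OF g(1), of x y] g xy by simp
  ultimately show "j \<in> edge_orbit \<Gamma> r ` nbrs adj r"
    using g by (auto simp: nbrs_def)
qed (auto simp: edge_orbits_def nbrs_def)

lemma orbit_fibre:
  assumes y: "y \<in> nbrs adj r"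
  shows "{z. (r, z) \<in> edge_orbit \<Gamma> r y} = {z \<in> nbrs adj r. edge_orbit \<Gamma> r z = edge_orbit \<Gamma> r y}"
proof (intro equalityI subsetI)
  fix z assume "z \<in> {z. (r, z) \<in> edge_orbit \<Gamma> r y}"
  then obtain g where g: "g \<in> \<Gamma>" "g r = r" "g y = z"
    by (auto simp: edge_orbit_def)
  have "adj (g r) (g y)"
    using g(1) y by (simp only: adj_translate nbrs_def mem_Collect_eq)
  then show "z \<in> {z \<in> nbrs adj r. edge_orbit \<Gamma> r z = edge_orbit \<Gamma> r y}"
    using edge_orbit_translate[OF g(1), of r y] g by (simp add: nbrs_def)
next
  fix z assume "z \<in> {z \<in> nbrs adj r. edge_orbit \<Gamma> r z = edge_orbit \<Gamma> r y}"
  then show "z \<in> {z. (r, z) \<in> edge_orbit \<Gamma> r y}"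
    using mem_edge_orbit[of r z] by simp
qed

text \<open>All neighbours in an orbit carry the same positive transition probability, so the total mass
  \<open>1\<close> leaves room for finitely many of them only; hence the cardinality in \<^const>\<open>orbit_d\<close> is
  that of a finite set.\<close>

lemma finite_orbit_fibre:
  assumes y: "y \<in> nbrs adj r"
  shows "finite {z. (r, z) \<in> edge_orbit \<Gamma> r y}"
proof (rule finite_if_finite_subsets_card_bdd[THEN conjunct1])
  fix F assume F: "F \<subseteq> {z. (r, z) \<in> edge_orbit \<Gamma> r y}" "finite F"
  have py: "p r y > 0"
    using y by (simp add: nbrs_def p_pos_iff)
  have "p r z = p r y" if "z \<in> F" for z
    using F that orbit_p_edge_orbit[of r z] orbit_p_edge_orbit[of r y] by (auto simp: orbit_fibre[OF y])
  then have "(\<Sum>z\<in>F. p r y) = (\<Sum>z\<in>F. p r z)"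
    by simp
  also have "\<dots> \<le> 1"
    by (rule has_sum_mono2[OF has_sum_finite[OF F(2)] p_row]) (auto simp: p_nonneg)
  finally have "real (card F) \<le> 1 / p r y"
    using py by (simp add: field_simps)
  then have "real (card F) \<le> of_int \<lceil>1 / p r y\<rceil>"
    by linarith
  then show "card F \<le> nat \<lceil>1 / p r y\<rceil>"
    by linarith
qed

text \<open>The neighbours of the root are partitioned by the orbit of their edge, and
  \<open>orbit_d\<close> counts the finite classes. Summing first over each class turns the sum over
  neighbours into the weighted sum over orbits in \<open>Phi\<close>.\<close>

lemma has_sum_orbits:
  fixes H :: "('v \<times> 'v) set \<Rightarrow> complex"
  assumes "((\<lambda>y. H (edge_orbit \<Gamma> r y)) has_sum S) (nbrs adj r)"
  shows "((\<lambda>j. of_nat (orbit_d r j) * H j) has_sum S) (edge_orbits adj \<Gamma>)"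
proof -
  define fib where "fib j = {z. (r, z) \<in> j}" for j :: "('v \<times> 'v) set"
  have fib: "fib j = {z \<in> nbrs adj r. edge_orbit \<Gamma> r z = j}" "finite (fib j)"
    if "j \<in> edge_orbits adj \<Gamma>" for j
    using that orbit_fibre finite_orbit_fibre by (auto simp: edge_orbits_eq fib_def)
  have orbit: "edge_orbit \<Gamma> r y \<in> edge_orbits adj \<Gamma>" if "y \<in> nbrs adj r" for y
    using that by (auto simp: edge_orbits_eq)
  have "bij_betw snd (Sigma (edge_orbits adj \<Gamma>) fib) (nbrs adj r)"
  proof (rule bij_betwI[where g = "\<lambda>y. (edge_orbit \<Gamma> r y, y)"])
    show "(\<lambda>y. (edge_orbit \<Gamma> r y, y)) \<in> nbrs adj r \<rightarrow> Sigma (edge_orbits adj \<Gamma>) fib"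
      using orbit by (auto simp: fib)
  qed (auto simp: fib)
  from has_sum_reindex_bij_betw[OF this, of "\<lambda>y. H (edge_orbit \<Gamma> r y)" S] assms
  have "((\<lambda>e. H (edge_orbit \<Gamma> r (snd e))) has_sum S) (Sigma (edge_orbits adj \<Gamma>) fib)"
    by simp
  then show ?thesis
  proof (rule has_sum_SigmaD)
    fix j assume j: "j \<in> edge_orbits adj \<Gamma>"
    show "((\<lambda>y. H (edge_orbit \<Gamma> r (snd (j, y)))) has_sum (of_nat (orbit_d r j) * H j)) (fib j)"
    proof (rule has_sum_finiteI[OF fib(2)[OF j]])
      have "(\<Sum>y\<in>fib j. H (edge_orbit \<Gamma> r (snd (j, y)))) = (\<Sum>y\<in>fib j. H j)"
        using fib(1)[OF j] by (intro sum.cong) auto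
      then show "of_nat (orbit_d r j) * H j = (\<Sum>y\<in>fib j. H (edge_orbit \<Gamma> r (snd (j, y))))"
        by (simp add: orbit_d_def fib_def)
    qed
  qed
qed

lemma kappa_upper:
  assumes "y \<in> nbrs adj r"
  shows "2 * sqrt (p r y * p y r) \<le> kappa adj \<Gamma> p"
proof -
  \<comment> \<open>\<open>kappa\<close> is a real supremum, which is an upper bound only for a
    bounded set; probabilities at most \<open>1\<close> give the bound \<open>2\<close>.\<close>
  have "bdd_above ((\<lambda>j. 2 * sqrt (orbit_p p j * orbit_p p (orbit_rev j))) ` edge_orbits adj \<Gamma>)"
  proof (rule bdd_aboveI2[where M = 2])
    fix j assume "j \<in> edge_orbits adj \<Gamma>"
    then obtain z where "j = edge_orbit \<Gamma> r z"
      by (auto simp: edge_orbits_eq)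
    moreover have "p r z * p z r \<le> 1 * 1"
      by (intro mult_mono p_le_1 p_nonneg) auto
    ultimately show "2 * sqrt (orbit_p p j * orbit_p p (orbit_rev j)) \<le> 2"
      by (simp add: orbit_p_edge_orbit orbit_rev_edge_orbit)
  qed
  moreover have "2 * sqrt (p r y * p y r)
      \<in> (\<lambda>j. 2 * sqrt (orbit_p p j * orbit_p p (orbit_rev j))) ` edge_orbits adj \<Gamma>"
    unfolding edge_orbits_eq image_image using assms
    by (intro image_eqI[of _ _ y]) (simp_all add: orbit_p_edge_orbit orbit_rev_edge_orbit)
  ultimately show ?thesis
    unfolding kappa_def by (rule cSup_upper[rotated])
qed

sublocale sqrt_series "nbrs adj r" "\<lambda>y. p r y * p y r" "kappa adj \<Gamma> p"
proof
  show pos: "p r y * p y r > 0" if "y \<in> nbrs adj r" for y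
    using that adj_sym[of r y] by (simp add: nbrs_def p_pos_iff)
  \<comment> \<open>The products are dominated by the row of \<open>p\<close> at \<open>r\<close>,
    which has mass \<open>1\<close>.\<close>
  have "(\<lambda>y. p r y * p y r) summable_on UNIV"
    by (rule summable_p[where B = 1]) (use p_nonneg p_le_1 in auto)
  then show "(\<lambda>y. p r y * p y r) summable_on nbrs adj r"
    by (rule summable_on_subset) auto
  show three: "infinite (nbrs adj r) \<or> card (nbrs adj r) \<ge> 3"
    using degree by (auto simp: min_degree3_def)
  show "2 * sqrt (p r y * p y r) \<le> kappa adj \<Gamma> p" if "y \<in> nbrs adj r" for y
    using that by (rule kappa_upper)
  obtain y where y: "y \<in> nbrs adj r"
    using three by fastforce
  have "0 < 2 * sqrt (p r y * p y r)"
    using pos[OF y] by simp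
  with kappa_upper[OF y] show "kappa adj \<Gamma> p > 0"
    by linarith
qed

lemma Phi_eq_cphi: "Phi adj \<Gamma> p r = cphi"
proof
  fix t :: complex
  define H where "H j = (csqrt (1 + 4 * of_real (orbit_p p j * orbit_p p (orbit_rev j)) * t\<^sup>2) - 1) / 2" for j
  have H: "H (edge_orbit \<Gamma> r y) = (csqrt (1 + 4 * of_real (p r y * p y r) * t\<^sup>2) - 1) / 2" for y
    by (simp add: H_def orbit_p_edge_orbit orbit_rev_edge_orbit)
  have "(\<lambda>y. norm (H (edge_orbit \<Gamma> r y))) summable_on nbrs adj r"
    unfolding H
    by (rule Infinite_Sum.abs_summable_on_comparison_test'[OF _ term_bound])
       (intro summable_on_cmult_left summable_on_cmult_right q_summable)
  then have "((\<lambda>y. H (edge_orbit \<Gamma> r y)) has_sum (\<Sum>\<^sub>\<infinity>y\<in>nbrs adj r. H (edge_orbit \<Gamma> r y))) (nbrs adj r)"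
    by (rule has_sum_infsum[OF abs_summable_summable])
  from has_sum_orbits[OF this]
  have "(\<Sum>\<^sub>\<infinity>j\<in>edge_orbits adj \<Gamma>. of_nat (orbit_d r j) * H j) = (\<Sum>\<^sub>\<infinity>y\<in>nbrs adj r. H (edge_orbit \<Gamma> r y))"
    by (rule infsumI)
  then show "Phi adj \<Gamma> p r t = cphi t"
    unfolding Phi_def cphi_def H by (simp add: H_def)
qed

section \<open>Parity, the reversing measure and the superharmonic function\<close>

lemma nstep_odd: "odd n \<Longrightarrow> nstep p n r r = 0"
proof -
  obtain d :: "'v \<Rightarrow> nat" and par where dp: "\<And>x. x \<noteq> r \<Longrightarrow> d x = Suc (d (par x))"
    "\<And>x y. adj x y \<Longrightarrow> (y \<noteq> r \<and> x = par y) \<or> (x \<noteq> r \<and> y = par x)"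
    by (rule tree_rooted[OF tree, of r]) blast
  have "even (d x) \<longleftrightarrow> odd (d y)" if "p x y \<noteq> 0" for x y
    using dp(2)[of x y] dp(1)[of x] dp(1)[of y] p_eq_0[of x y] that by (metis even_Suc)
  from nstep_parity[where d = d and n = n and x = r and y = r, OF this] show "odd n \<Longrightarrow> nstep p n r r = 0"
    by auto
qed

text \<open>\<open>m\<close> is the reversing measure built along geodesics, for which detailed
  balance only has to be checked between a vertex and its parent. The weight is \<open>1 / m\<close>
  because the vectors are written as \<open>p^n(r,x)\<close>, which is \<open>m x\<close> times
  \<open>p^n(x,r)\<close>.\<close>

lemma reversible_moments:
  obtains w where "moments (\<lambda>n. nstep p n r r) (\<lambda>n. nstep p n r) w r"
proof -
  obtain d :: "'v \<Rightarrow> nat" and par where d0: "d r = 0" and par: "\<And>x. x \<noteq> r \<Longrightarrow> adj x (par x)"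
    and dS: "\<And>x. x \<noteq> r \<Longrightarrow> d x = Suc (d (par x))"
    and edge: "\<And>x y. adj x y \<Longrightarrow> (y \<noteq> r \<and> x = par y) \<or> (x \<noteq> r \<and> y = par x)"
    by (rule tree_rooted[OF tree, of r]) (rule that; assumption)
  obtain m :: "'v \<Rightarrow> real" where m: "m r = 1" "\<And>x. x \<noteq> r \<Longrightarrow> m x = p (par x) x / p x (par x) * m (par x)"
    using geodesic_product[of d r par "\<lambda>x y. p y x / p x y"] d0 dS by metis
  have m_pos: "m x > 0" for x
  proof (induction "d x" arbitrary: x)
    case 0
    then have "x = r"
      using dS[of x] by (cases "x = r") auto
    then show ?case using m by simp
  next
    case (Suc n)
    then have "x \<noteq> r"
      using Suc(2) d0 by auto
    then have "d (par x) = n" "p x (par x) > 0" "p (par x) x > 0"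
      using dS[of x] Suc par[of x] adj_sym by (auto simp: p_pos_iff)
    with Suc m(2)[OF \<open>x \<noteq> r\<close>] show ?case
      by simp
  qed
  have parent: "m x * p x (par x) = m (par x) * p (par x) x" if "x \<noteq> r" for x
    using m(2)[OF that] par[OF that] by (simp add: p_pos_iff[symmetric])
  have balance: "m x * p x y = m y * p y x" for x y
  proof (cases "adj x y")
    case True
    then show ?thesis
      using edge[OF True] parent[of x] parent[of y] by auto
  next
    case False
    then show ?thesis
      using adj_sym[of x y] by (simp add: p_eq_0)
  qed
  have reversed: "nstep p j x r = 1 / m x * nstep p j r x" for j x
    using nstep_reversible[where m = m and x = x and n = j and y = r] balance m(1) m_pos[of x]
    by (simp add: field_simps)
  have "moments (\<lambda>n. nstep p n r r) (\<lambda>n. nstep p n r) (\<lambda>x. 1 / m x) r"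
  proof
    show "((\<lambda>x. 1 / m x * (nstep p i r x * nstep p j r x)) has_sum nstep p (i + j) r r) UNIV" for i j
    proof -
      have "1 / m x * (nstep p i r x * nstep p j r x) = nstep p i r x * nstep p j x r" for x
        by (simp add: reversed[of j x])
      then show ?thesis
        by (simp only: chapman_kolmogorov)
    qed
  qed (use m m_pos in \<open>auto intro: less_imp_le\<close>)
  then show ?thesis
    by (rule that)
qed

text \<open>The weight \<open>u x y\<close> below is the value that \<open>p(y,x) F(x,y)\<close>, with \<open>F\<close> the first-passage
  generating function, takes when the Green function equals \<open>t\<close>: it solves
  \<open>u\<^sup>2 + u / t = p(x,y) p(y,x)\<close>.\<close>

lemma superharmonic_function:
  assumes t: "t > 0"
  obtains g where "g r = 1" and "\<And>x. g x > 0" and "\<And>x. t < 1 \<Longrightarrow> g x \<le> 1"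
    and "\<And>x. ((\<lambda>z. p x z * g z) has_sum (phi t / t * g x - (if x = r then 1 / t else 0))) UNIV"
proof -
  obtain d :: "'v \<Rightarrow> nat" and par where d0: "d r = 0" and par: "\<And>x. x \<noteq> r \<Longrightarrow> adj x (par x)"
    and dS: "\<And>x. x \<noteq> r \<Longrightarrow> d x = Suc (d (par x))"
    and edge: "\<And>x y. adj x y \<Longrightarrow> (y \<noteq> r \<and> x = par y) \<or> (x \<noteq> r \<and> y = par x)"
    by (rule tree_rooted[OF tree, of r]) (rule that; assumption)
  define u where "u x y = (sqrt (1 + 4 * (p x y * p y x) * t\<^sup>2) - 1) / (2 * t)" for x y
  have u_sym: "u x y = u y x" for x y
    by (simp add: u_def mult.commute)
  have u_pos: "u x y > 0" if "adj x y" for x y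
    using that t adj_sym[of x y] by (simp add: u_def p_pos_iff[symmetric])
  have u_zero: "u x y = 0" if "\<not> adj x y" for x y
    using that by (simp add: u_def p_eq_0)
  \<comment> \<open>This estimate yields \<open>g <= 1\<close> for \<open>t < 1\<close>; it is the
    inequality \<open>sqrt (1 + 2 a) <= 1 + a\<close>.\<close>
  have u_le: "u x y \<le> p x y * p y x * t" for x y
  proof -
    have c: "p x y * p y x \<ge> 0"
      using p_nonneg by simp
    have "sqrt (1 + 4 * (p x y * p y x) * t\<^sup>2) \<le> 1 + 2 * (p x y * p y x) * t\<^sup>2"
    proof (rule real_le_lsqrt)
      have "(1 + 2 * (p x y * p y x) * t\<^sup>2)\<^sup>2 = 1 + 4 * (p x y * p y x) * t\<^sup>2 + (2 * (p x y * p y x) * t\<^sup>2)\<^sup>2"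
        by (simp add: power2_eq_square algebra_simps)
      then show "1 + 4 * (p x y * p y x) * t\<^sup>2 \<le> (1 + 2 * (p x y * p y x) * t\<^sup>2)\<^sup>2"
        by simp
    qed (use c in auto)
    then show ?thesis
      using t by (simp add: u_def field_simps power2_eq_square)
  qed
  have u_eq: "(u x y + 1 / t) * u x y = p x y * p y x" for x y
  proof -
    define s where "s = sqrt (1 + 4 * (p x y * p y x) * t\<^sup>2)"
    have s2: "s\<^sup>2 = 1 + 4 * (p x y * p y x) * t\<^sup>2"
      using p_nonneg by (simp add: s_def)
    have "(u x y + 1 / t) * u x y = (s\<^sup>2 - 1) / (4 * t\<^sup>2)"
      using t unfolding u_def s_def[symmetric] by (simp add: field_simps power2_eq_square)
    then show ?thesis
      using t by (simp add: s2)
  qed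
  have root_sum: "(u r has_sum ((phi t - 1) / t)) UNIV"
  proof -
    have "((\<lambda>y. (sqrt (1 + 4 * (p r y * p y r) * t\<^sup>2) - 1) / 2 / t) has_sum ((phi t - 1) / t)) (nbrs adj r)"
      by (intro has_sum_divide_const phi_summable)
    then have "(u r has_sum ((phi t - 1) / t)) (nbrs adj r)"
      by (simp add: u_def[abs_def] divide_divide_eq_left)
    then show ?thesis
      by (rule has_sum_cong_neutral[THEN iffD1, rotated -1]) (auto simp: u_zero nbrs_def)
  qed
  \<comment> \<open>A group element moving \<open>r\<close> to \<open>x\<close> permutes the
    vertices and preserves \<open>u\<close>, so all rows of \<open>u\<close> have the same
    mass.\<close>
  have u_sum: "(u x has_sum ((phi t - 1) / t)) UNIV" for x
  proof -
    obtain \<gamma> where \<gamma>: "\<gamma> \<in> \<Gamma>" "\<gamma> r = x"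
      using transitive by (auto simp: vertex_transitive_def)
    have "bij \<gamma>"
      using group \<gamma> by (auto simp: aut_subgroup_def is_aut_def)
    have "u x (\<gamma> z) = u r z" for z
      using \<gamma> p_invariant[OF \<gamma>(1)] by (metis (no_types, lifting) u_def)
    then show ?thesis
      using has_sum_reindex_bij_betw[OF \<open>bij \<gamma>\<close>, of "u x" "(phi t - 1) / t"] root_sum by simp
  qed
  \<comment> \<open>Each factor plays the role of \<open>F(x, par x)\<close>, so \<open>g x\<close>
    plays the role of the first-passage generating function from \<open>x\<close> to
    \<open>r\<close>.\<close>
  obtain g where g: "g r = 1" "\<And>x. x \<noteq> r \<Longrightarrow> g x = u x (par x) / p (par x) x * g (par x)"
    using geodesic_product[of d r par "\<lambda>x y. u x y / p y x"] d0 dS by metis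
  have g_ind: "Q x" if "Q r" and step: "\<And>x. x \<noteq> r \<Longrightarrow> Q (par x) \<Longrightarrow> Q x" for Q x
  proof (induction "d x" arbitrary: x)
    case 0
    then show ?case
      using dS[of x] \<open>Q r\<close> by (cases "x = r") auto
  next
    case (Suc n)
    then have "x \<noteq> r"
      using Suc(2) d0 by auto
    show ?case
      by (rule step[OF \<open>x \<noteq> r\<close> Suc(1)]) (use Suc(2) dS[OF \<open>x \<noteq> r\<close>] in simp)
  qed
  have p_par: "p (par x) x > 0" if "x \<noteq> r" for x
    using par[OF that] adj_sym by (simp add: p_pos_iff)
  have g_pos: "g x > 0" for x
  proof (induction rule: g_ind)
    case (2 x)
    then show ?case
      using g(2)[of x] p_par[of x] u_pos[OF par[of x]] by simp
  qed (use g in simp)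
  have g_le: "g x \<le> 1" if "t < 1" for x
  proof (induction rule: g_ind)
    case (2 x)
    have "u x (par x) \<le> p x (par x) * p (par x) x * t"
      by (rule u_le)
    also have "\<dots> \<le> 1 * p (par x) x * 1"
      using \<open>t < 1\<close> t p_nonneg p_le_1 by (intro mult_mono) auto
    finally have "u x (par x) / p (par x) x \<le> 1"
      using p_par[OF 2(1)] by simp
    then have "u x (par x) / p (par x) x * g (par x) \<le> 1 * 1"
      using 2(2) g_pos[of "par x"] by (intro mult_mono) (auto intro: less_imp_le)
    then show ?case
      using g(2)[OF 2(1)] by simp
  qed (use g in simp)
  \<comment> \<open>Towards a child the factor of \<open>g\<close> gives exactly
    \<open>u x z\<close>. Towards the parent the quadratic equation for \<open>u\<close> adds
    \<open>1 / t\<close>. The root has no parent, and this missing \<open>1 / t\<close> is the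
    defect in the equation for \<open>g\<close>.\<close>
  have step: "p x z * g z = g x * (u x z + (if x \<noteq> r \<and> z = par x then 1 / t else 0))" for x z
  proof (cases "adj x z")
    case True
    show ?thesis
    proof (cases "x \<noteq> r \<and> z = par x")
      case True
      then have "p z x * g x = u x z * g z"
        using g(2)[of x] p_par[of x] by simp
      then have "u x z * (p x z * g z) = p x z * p z x * g x"
        by (simp add: mult_ac)
      also have "\<dots> = u x z * (g x * (u x z + 1 / t))"
        by (simp add: u_eq[symmetric] mult_ac)
      finally show ?thesis
        using True u_pos[OF \<open>adj x z\<close>] by simp
    next
      case False
      then have "z \<noteq> r" "x = par z"
        using edge[OF \<open>adj x z\<close>] by auto
      then show ?thesis
        using False g(2)[of z] p_par[of z] u_sym[of x z] by auto
    qed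
  next
    case False
    then show ?thesis
      using par[of x] by (auto simp: p_eq_0 u_zero)
  qed
  have "((\<lambda>z. p x z * g z) has_sum (phi t / t * g x - (if x = r then 1 / t else 0))) UNIV" for x
  proof -
    have "((\<lambda>z. if x \<noteq> r \<and> z = par x then 1 / t else 0) has_sum (if x = r then 0 else 1 / t)) UNIV"
      by (rule has_sum_finite_neutralI[of "{par x}"]) auto
    from has_sum_cmult_right[OF has_sum_add[OF u_sum this], of "g x" x]
    have "((\<lambda>z. p x z * g z) has_sum (g x * ((phi t - 1) / t + (if x = r then 0 else 1 / t)))) UNIV"
      by (simp only: step)
    moreover have "g x * ((phi t - 1) / t + (if x = r then 0 else 1 / t))
        = phi t / t * g x - (if x = r then 1 / t else 0)"
      using g(1) t by (auto simp: field_simps)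
    ultimately show ?thesis
      by simp
  qed
  from g(1) g_pos g_le this show ?thesis
    by (rule that[of g])
qed

text \<open>The defect at the root has the favourable sign, so \<open>P g <= (phi t / t) g\<close>
  everywhere, and positivity of \<open>g\<close> gives the bound for every
  \<open>t > 0\<close>.\<close>

lemma nstep_le_power:
  assumes t: "t > 0"
  shows "nstep p n r r \<le> (phi t / t) ^ n"
proof (rule superharmonic_function[OF t])
  fix g :: "'v \<Rightarrow> real"
  assume g: "g r = 1" "\<And>x. g x > 0"
    "\<And>x. ((\<lambda>z. p x z * g z) has_sum (phi t / t * g x - (if x = r then 1 / t else 0))) UNIV"
  have "nstep p n r r * g r \<le> (phi t / t) ^ n * g r"
  proof (rule nstep_supersolution[where g = g])
    show "(\<lambda>z. p x z * g z) summable_on UNIV" for x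
      by (rule has_sum_imp_summable[OF g(3)[of x]])
    show "(\<Sum>\<^sub>\<infinity>z. p x z * g z) \<le> phi t / t * g x" for x
      using infsumI[OF g(3)[of x]] t by simp
    show "phi t / t \<ge> 0"
      using t phi_ge_1[of t] by simp
  qed (use g in \<open>auto intro: less_imp_le\<close>)
  then show ?thesis
    using g by simp
qed

text \<open>The restriction to \<open>t < 1\<close> gives both ingredients of
  \<open>resolvent_sums\<close>: \<open>g\<close> is bounded and \<open>phi t / t > 1\<close>. The
  factor \<open>t\<close> normalises the defect \<open>1 / t\<close> at the root to
  \<open>1\<close>.\<close>

lemma green_sums:
  assumes t: "0 < t" "t < 1"
  shows "(\<lambda>n. nstep p n r r / (phi t / t) ^ Suc n) sums t"
proof (rule superharmonic_function[OF \<open>0 < t\<close>])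
  fix g :: "'v \<Rightarrow> real"
  assume g: "g r = 1" "\<And>x. g x > 0" "\<And>x. t < 1 \<Longrightarrow> g x \<le> 1"
    "\<And>x. ((\<lambda>z. p x z * g z) has_sum (phi t / t * g x - (if x = r then 1 / t else 0))) UNIV"
  have "(\<lambda>n. nstep p n r r / (phi t / t) ^ Suc n) sums (t * g r)"
  proof (rule resolvent_sums[where h = "\<lambda>x. t * g x" and B = 1])
    show "\<bar>t * g x\<bar> \<le> 1" for x
    proof -
      have "t * g x \<le> 1 * 1"
        using t g(2)[of x] g(3)[OF t(2), of x] by (intro mult_mono) auto
      moreover have "t * g x > 0"
        using t g(2)[of x] by simp
      ultimately show ?thesis
        by simp
    qed
    have "1 < 1 / t"
      using t by simp
    also have "1 / t \<le> phi t / t"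
      using t phi_ge_1 by (intro divide_right_mono) auto
    finally show "phi t / t > 1" .
    show "phi t / t * (t * g x) - (\<Sum>\<^sub>\<infinity>z. p x z * (t * g z)) = (if x = r then 1 else 0)" for x
    proof -
      have "((\<lambda>z. t * (p x z * g z)) has_sum (t * (phi t / t * g x - (if x = r then 1 / t else 0)))) UNIV"
        by (intro has_sum_cmult_right g(4))
      then have "(\<Sum>\<^sub>\<infinity>z. p x z * (t * g z)) = t * (phi t / t * g x - (if x = r then 1 / t else 0))"
        by (intro infsumI) (simp only: mult.left_commute)
      then show ?thesis
        using t by (simp only:) (simp add: right_diff_distrib)
    qed
  qed
  then show ?thesis
    using g by simp
qed

end

section \<open>Functional equation and spectral radius of the walk\<close>

theorem theorem5p2:
  fixes adj :: "'v \<Rightarrow> 'v \<Rightarrow> bool" and \<Gamma> :: "('v \<Rightarrow> 'v) set"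
    and p :: "'v \<Rightarrow> 'v \<Rightarrow> real" and r :: 'v
  assumes "countable (UNIV :: 'v set)"
    and "is_tree adj" and "min_degree3 adj"
    and "aut_subgroup adj \<Gamma>" and "vertex_transitive \<Gamma>"
    and "nn_stochastic adj p" and "invariant \<Gamma> p"
    and "(\<lambda>j. real (orbit_d r j) * orbit_p p (orbit_rev j)) summable_on edge_orbits adj \<Gamma>"
  shows "Phi adj \<Gamma> p r analytic_on W_set (kappa adj \<Gamma> p)
    \<and> (\<forall>z\<in>U_set (spec_rad p r) (kappa adj \<Gamma> p).
          z * green p r z = Phi adj \<Gamma> p r (green p r z))
    \<and> (\<forall>t::real. t > 0 \<longrightarrow> Phi adj \<Gamma> p r (of_real t) / of_real t \<in> \<real>
          \<and> spec_rad p r \<le> Re (Phi adj \<Gamma> p r (of_real t) / of_real t))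
    \<and> (\<exists>\<theta>::real. \<theta> > 0
          \<and> deriv (Phi adj \<Gamma> p r) (of_real \<theta>) = Phi adj \<Gamma> p r (of_real \<theta>) / of_real \<theta>
          \<and> (\<forall>t::real. t > 0 \<and> deriv (Phi adj \<Gamma> p r) (of_real t) = Phi adj \<Gamma> p r (of_real t) / of_real t
                \<longrightarrow> t = \<theta>)
          \<and> complex_of_real (spec_rad p r) = Phi adj \<Gamma> p r (of_real \<theta>) / of_real \<theta>)"
proof -
  interpret tree_walk adj \<Gamma> p r
    by (rule tree_walk.intro) (fact assms)+
  obtain w where w: "moments (\<lambda>n. nstep p n r r) (\<lambda>n. nstep p n r) w r"
    using reversible_moments .
  interpret moments "\<lambda>n. nstep p n r r" "\<lambda>n. nstep p n r" w r
    by (rule w)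
  interpret R: resolvent_series "\<lambda>n. nstep p n r r" "\<lambda>n. nstep p n r" w r
      "nbrs adj r" "\<lambda>y. p r y * p y r" "kappa adj \<Gamma> p"
    by unfold_locales (auto simp: nstep_nonneg nstep_le_1 nstep_odd)
  have rho: "R.rho = spec_rad p r"
    by (simp add: R.rho_def spec_rad_def)
  have G: "R.G = green p r"
    by (simp add: R.G_def[abs_def] green_def[abs_def])
  interpret S: solvable_resolvent "\<lambda>n. nstep p n r r" "\<lambda>n. nstep p n r" w r
      "nbrs adj r" "\<lambda>y. p r y * p y r" "kappa adj \<Gamma> p"
  proof
    show "R.rho \<le> phi t / t" if "t > 0" for t
      by (rule R.rho_le) (use that phi_ge_1[of t] nstep_le_power[OF that] in auto)
    show "R.G (of_real (phi t / t)) = of_real t" if t: "0 < t" "t < 1" for t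
    proof -
      have "(\<lambda>n. complex_of_real (nstep p n r r / (phi t / t) ^ Suc n)) sums of_real t"
        by (intro sums_of_real green_sums t)
      then show ?thesis
        by (simp add: R.G_def sums_iff)
    qed
  qed
  obtain \<theta> where \<theta>: "\<theta> > 0" "phi' \<theta> = phi \<theta> / \<theta>"
    "\<And>t. t > 0 \<Longrightarrow> phi' t = phi t / t \<Longrightarrow> t = \<theta>" "\<And>t. t > 0 \<Longrightarrow> phi \<theta> / \<theta> \<le> phi t / t"
    by (rule theta_exists) (rule that; assumption)
  have quotient: "Phi adj \<Gamma> p r (of_real t) / of_real t = of_real (phi t / t)" for t
    by (simp add: Phi_eq_cphi cphi_of_real)
  have deriv: "deriv (Phi adj \<Gamma> p r) (of_real t) = of_real (phi' t)" for t
    by (simp add: Phi_eq_cphi deriv_cphi)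
  show ?thesis
    unfolding quotient deriv of_real_eq_iff Re_complex_of_real
  proof (intro conjI allI impI ballI exI[of _ \<theta>])
    show "Phi adj \<Gamma> p r analytic_on W_set (kappa adj \<Gamma> p)"
      unfolding Phi_eq_cphi analytic_on_open[OF open_W_set] by (rule holomorphic_cphi)
    show "z * green p r z = Phi adj \<Gamma> p r (green p r z)"
      if "z \<in> U_set (spec_rad p r) (kappa adj \<Gamma> p)" for z
      using S.functional_equation[of z] that by (simp add: rho G Phi_eq_cphi)
    show "complex_of_real (phi t / t) \<in> \<real>" for t
      by simp
    show "spec_rad p r \<le> phi t / t" if "t > 0" for t
      using S.rho_le_phi[OF that] by (simp add: rho)
    show "t = \<theta>" if "t > 0 \<and> phi' t = phi t / t" for t
      using \<theta>(3)[of t] that by blast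
    \<comment> \<open>The superharmonic bound at \<theta> gives one inequality; minimality of
      \<theta> together with \<open>rho_ge\<close> gives the other.\<close>
    show "spec_rad p r = phi \<theta> / \<theta>"
      using S.rho_le_phi[OF \<theta>(1)] S.rho_ge[OF \<theta>(4)] rho by simp
  qed (rule \<theta>)+
qed

end
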